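(* Assume that $p\log p\le n^2$ and that, for some $a\in(0,1/2)$, $p^{1-a}(\log p)^2\ge16n$. Then for any estimator $\widehat\eta$ and for all integers $k$ such that $\sqrt{p\log p}\le k\le p$, one has $$\frac{R(\widehat\eta,1)}{\frac1n\sqrt{\frac pn}}+\frac{R(\widehat\eta,k)}{\frac{p\log p}{n^2}}\ge\frac{a^2}{4^5}.$$
   Context: For $\beta\in\mathbb{R}^p$, $\sigma>0$, $\mathbb{E}_{\beta,\sigma}$ denotes expectation under the law of $(Y,\mathbf{X})$ where $\mathbf{X}\in\mathbb{R}^{n\times p}$ has i.i.d. rows $\mathcal{N}(0,\mathbf{I}_p)$, $Y=\mathbf{X}\beta+\epsilon$ and $\epsilon\sim\mathcal{N}(0,\sigma^2\mathbf{I}_n)$ is independent of $\mathbf{X}$. Set $\eta(\beta,\sigma):=\frac{\|\beta\|_2^2}{\sigma^2+\|\beta\|_2^2}$. $\mathbb{B}_0[k]$ is the set of vectors of $\mathbb{R}^p$ with at most $k$ nonzero coordinates. For an estimator $\widehat\eta$ (a measurable function of $(Y,\mathbf{X})$), the maximal risk is $$R(\widehat\eta,k):=\sup_{\beta\in\mathbb{B}_0[k],\ \sigma>0}\mathbb{E}_{\beta,\sigma}\left[\{\widehat\eta-\eta(\beta,\sigma)\}^2\right].$$ *)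

theory Defs
  imports "HOL-Probability.Probability"
begin

text \<open>
  Vectors of dimension \<open>n\<close> are elements of \<open>real ^ 'n\<close> with \<open>CARD('n) = n\<close>; an
  \<open>n \<times> p\<close> matrix is an element of \<open>real ^ 'p ^ 'n\<close>, whose \<open>i\<close>-th row is \<open>X $ i\<close>.
\<close>

text \<open>The law of a random vector whose components
  are i.i.d. with law \<open>M\<close>.\<close>

definition iid_vec :: "('a::topological_space) measure \<Rightarrow> ('a ^ 'n::finite) measure" where
  "iid_vec M = distr (Pi\<^sub>M UNIV (\<lambda>_. M)) borel (\<lambda>f. \<chi> i. f i)"

text \<open>\<open>N(0, s\<^sup>2 I)\<close>, parametrised by the standard deviation \<open>s\<close>.\<close>

definition gaussian_vec :: "real \<Rightarrow> (real ^ 'n::finite) measure" where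
  "gaussian_vec s = iid_vec (density lborel (\<lambda>x. ennreal (normal_density 0 s x)))"

definition gaussian_design :: "(real ^ 'p::finite ^ 'n::finite) measure" where
  "gaussian_design = iid_vec (gaussian_vec 1)"

text \<open>The joint law of \<open>(Y, X)\<close>; the product measure encodes independence of design and noise.\<close>

definition model_law ::
  "real ^ 'p::finite \<Rightarrow> real \<Rightarrow> ((real ^ 'n::finite) \<times> (real ^ 'p ^ 'n)) measure" where
  "model_law \<beta> \<sigma> =
     distr (gaussian_design \<Otimes>\<^sub>M gaussian_vec \<sigma>) borel (\<lambda>(X, \<epsilon>). (X *v \<beta> + \<epsilon>, X))"

definition eta :: "real ^ 'p::finite \<Rightarrow> real \<Rightarrow> real" where
  "eta \<beta> \<sigma> = (norm \<beta>)\<^sup>2 / (\<sigma>\<^sup>2 + (norm \<beta>)\<^sup>2)"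

definition B0 :: "nat \<Rightarrow> (real ^ 'p::finite) set" where
  "B0 k = {\<beta>. card {i. \<beta> $ i \<noteq> 0} \<le> k}"

text \<open>The risk of an arbitrary real-valued estimator may be infinite, hence the values in
  \<open>ennreal\<close> (a Bochner integral would be \<open>0\<close> for a non-integrable squared error).\<close>

definition max_risk ::
  "((real ^ 'n::finite) \<times> (real ^ 'p::finite ^ 'n) \<Rightarrow> real) \<Rightarrow> nat \<Rightarrow> ennreal" where
  "max_risk h k =
     (SUP (\<beta>, \<sigma>) \<in> B0 k \<times> {0<..}. \<integral>\<^sup>+ z. ennreal ((h z - eta \<beta> \<sigma>)\<^sup>2) \<partial>model_law \<beta> \<sigma>)"

end

theory Submission
  imports Defs
begin

text \<open>
  The null hypothesis \<open>\<beta> = 0\<close>, \<open>\<sigma> = 1\<close> is compared with a mixture over \<open>K\<close>-sparse \<open>\<beta>\<close>, where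
  \<open>K = \<lfloor>sqrt (p ln p)\<rfloor>\<close>: the coordinates are split into \<open>K\<close> blocks, and \<open>\<beta>\<close> has one nonzero entry, of
  fixed size and uniformly distributed position, in each block, with \<open>\<parallel>\<beta>\<parallel>\<^sup>2 = \<Delta>\<close> and \<open>\<sigma>\<^sup>2 = 1 - \<Delta>\<close>, where
  \<open>\<Delta> = (a / 20) sqrt (p ln p) / n\<close>.  Then \<open>Y\<close> has the same marginal law under all hypotheses, and the
  likelihood ratios satisfy \<open>E\<^sub>0 (L\<^sub>\<beta> L\<^sub>\<gamma>) = (1 - \<beta> \<bullet> \<gamma>) ^ (-n)\<close>: after integrating out \<open>Y\<close>, only the
  forms \<open>x \<bullet> (\<beta> + \<gamma>)\<close> and \<open>x \<bullet> (\<beta> - \<gamma>)\<close> of a row \<open>x\<close> remain, which are independent as \<open>\<parallel>\<beta>\<parallel> = \<parallel>\<gamma>\<parallel>\<close>.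
  Under the block prior the number of agreeing blocks is binomial, so the mixture has second moment at
  most \<open>p powr (a / 2)\<close>.  This does not make the hypotheses indistinguishable, but a constrained risk
  inequality in the manner of Brown and Low gives \<open>\<Delta>\<^sup>2 / 2 \<le> p powr (a / 2) * R(1) + R(k)\<close>, and the
  assumption on \<open>p powr (1 - a)\<close> makes the factor \<open>p powr (a / 2)\<close> harmless at the given scales.
\<close>

section \<open>Vectors with i.i.d. components\<close>

lemma vec_nth_measurable [measurable]:
  "(\<lambda>x::'a::euclidean_space ^ 'n::finite. x $ i) \<in> borel_measurable borel"
  by (intro borel_measurable_continuous_onI continuous_intros)

lemma vec_lambda_measurable:
  fixes M :: "'a::euclidean_space measure"
  assumes [measurable_cong]: "sets M = sets borel"
  shows "(\<lambda>f. \<chi> i::'n::finite. f i) \<in> borel_measurable (Pi\<^sub>M UNIV (\<lambda>_. M))"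
proof (subst borel_measurable_euclidean_space, intro ballI)
  fix b :: "'a ^ 'n" assume "b \<in> Basis"
  then obtain i u where b: "b = axis i u" by (auto simp: Basis_vec_def)
  show "(\<lambda>f. (\<chi> i. f i) \<bullet> b) \<in> borel_measurable (Pi\<^sub>M UNIV (\<lambda>_. M))"
    unfolding b inner_axis by simp
qed

lemma sets_iid_vec [simp, measurable_cong]: "sets (iid_vec M) = sets borel"
  by (simp add: iid_vec_def)

lemma sets_gaussian_vec [simp, measurable_cong]: "sets (gaussian_vec s) = sets borel"
  by (simp add: gaussian_vec_def)

lemma sets_gaussian_design [simp, measurable_cong]: "sets gaussian_design = sets borel"
  by (simp add: gaussian_design_def)

lemma nn_integral_iid_vec:
  fixes M :: "'a::euclidean_space measure" and g :: "'a ^ 'n::finite \<Rightarrow> ennreal"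
  assumes [measurable_cong]: "sets M = sets borel" and [measurable]: "g \<in> borel_measurable borel"
  shows "(\<integral>\<^sup>+x. g x \<partial>iid_vec M) = (\<integral>\<^sup>+f. g (\<chi> i. f i) \<partial>Pi\<^sub>M UNIV (\<lambda>_. M))"
  unfolding iid_vec_def
  by (subst nn_integral_distr) (auto intro: vec_lambda_measurable[OF assms(1)])

lemma nn_integral_iid_vec_prod:
  fixes M :: "'a::euclidean_space measure" and g :: "'n::finite \<Rightarrow> 'a \<Rightarrow> ennreal"
  assumes "sigma_finite_measure M" and [measurable_cong]: "sets M = sets borel"
    and [measurable]: "\<And>i. g i \<in> borel_measurable borel"
  shows "(\<integral>\<^sup>+x. (\<Prod>i\<in>UNIV. g i (x $ i)) \<partial>iid_vec M) = (\<Prod>i\<in>UNIV. \<integral>\<^sup>+x. g i x \<partial>M)"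
proof -
  interpret product_sigma_finite "\<lambda>_::'n. M"
    using assms(1) by (simp add: product_sigma_finite_def)
  have "(\<integral>\<^sup>+x. (\<Prod>i\<in>UNIV. g i (x $ i)) \<partial>iid_vec M)
    = (\<integral>\<^sup>+f. (\<Prod>i\<in>UNIV. g i (f i)) \<partial>Pi\<^sub>M UNIV (\<lambda>_. M))"
    by (subst nn_integral_iid_vec) (auto simp: assms)
  also have "\<dots> = (\<Prod>i\<in>UNIV. \<integral>\<^sup>+x. g i x \<partial>M)"
    by (rule product_nn_integral_prod) auto
  finally show ?thesis .
qed

lemma prob_space_iid_vec:
  fixes M :: "'a::euclidean_space measure"
  assumes "prob_space M" "sets M = sets borel"
  shows "prob_space (iid_vec M :: ('a ^ 'n::finite) measure)"
proof -
  interpret P: product_prob_space "\<lambda>_::'n. M" UNIV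
    using assms(1)
    by (simp add: product_prob_space_def product_prob_space_axioms_def product_sigma_finite_def
        prob_space_imp_sigma_finite)
  show ?thesis
    unfolding iid_vec_def by (rule P.prob_space_distr[OF vec_lambda_measurable[OF assms(2)]])
qed

lemma prob_space_gaussian_vec: "0 < s \<Longrightarrow> prob_space (gaussian_vec s)"
  unfolding gaussian_vec_def by (intro prob_space_iid_vec prob_space_normal_density) auto

lemma prob_space_gaussian_design: "prob_space gaussian_design"
  unfolding gaussian_design_def by (intro prob_space_iid_vec prob_space_gaussian_vec) auto

section \<open>Lebesgue densities of vectors with i.i.d. components\<close>

text \<open>A measure that has the right values on open boxes is Lebesgue measure, and the preimage
  of a box under the passage from functions to vectors is a product of intervals.\<close>

lemma iid_vec_lborel: "iid_vec lborel = (lborel :: (real ^ 'n::finite) measure)"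
proof (rule lborel_eqI[symmetric])
  interpret product_sigma_finite "\<lambda>_::'n. lborel :: real measure"
    by (simp add: product_sigma_finite_def sigma_finite_lborel)
  fix l u :: "real ^ 'n"
  assume lu: "\<And>b. b \<in> Basis \<Longrightarrow> l \<bullet> b \<le> u \<bullet> b"
  have le: "l $ i \<le> u $ i" for i
    using lu[of "axis i 1"] by (simp add: inner_axis axis_in_Basis_iff)
  have pre: "(\<lambda>f. \<chi> i. f i) -` box l u \<inter> space (Pi\<^sub>M UNIV (\<lambda>_::'n. lborel))
      = Pi\<^sub>E UNIV (\<lambda>i. {l $ i <..< u $ i})"
    by (auto simp: space_PiM mem_box_cart PiE_def Pi_def)
  have "emeasure (iid_vec lborel :: (real ^ 'n) measure) (box l u)
     = (\<Prod>i\<in>UNIV. ennreal (u $ i - l $ i))"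
    unfolding iid_vec_def
    by (subst emeasure_distr)
      (auto simp: pre le intro!: vec_lambda_measurable emeasure_PiM[THEN trans])
  also have "\<dots> = ennreal (\<Prod>i\<in>UNIV. u $ i - l $ i)"
    by (rule prod_ennreal) (simp add: le)
  also have "(\<Prod>i\<in>UNIV. u $ i - l $ i) = (\<Prod>b\<in>Basis. (u - l) \<bullet> b)"
  proof -
    have inj: "inj (\<lambda>i::'n. axis i (1::real))" by (auto simp: inj_on_def axis_eq_axis)
    have B: "(Basis :: (real ^ 'n) set) = range (\<lambda>i. axis i 1)"
      by (auto simp: Basis_vec_def)
    show ?thesis unfolding B by (subst prod.reindex[OF inj]) (simp add: inner_axis)
  qed
  finally show "emeasure (iid_vec lborel) (box l u) = ennreal (\<Prod>b\<in>Basis. (u - l) \<bullet> b)" .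
qed simp

text \<open>On a rectangle, the integral of a product of one-variable functions factorises, and
  rectangles determine a product measure. The resulting density is then carried along the map from
  functions to vectors.\<close>

lemma iid_vec_density:
  fixes f :: "real \<Rightarrow> ennreal"
  assumes [measurable]: "f \<in> borel_measurable borel" and "sigma_finite_measure (density lborel f)"
  shows "iid_vec (density lborel f) = density lborel (\<lambda>x::real ^ 'n::finite. \<Prod>i\<in>UNIV. f (x $ i))"
proof -
  interpret D: product_sigma_finite "\<lambda>_::'n. density lborel f"
    using assms(2) by (simp add: product_sigma_finite_def)
  interpret L: product_sigma_finite "\<lambda>_::'n. lborel :: real measure"
    by (simp add: product_sigma_finite_def sigma_finite_lborel)
  have m: "(\<lambda>x. \<Prod>i\<in>UNIV. f (x i)) \<in> borel_measurable (Pi\<^sub>M UNIV (\<lambda>_::'n. lborel :: real measure))"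
    by measurable
  have "density (Pi\<^sub>M UNIV (\<lambda>_::'n. lborel)) (\<lambda>x. \<Prod>i\<in>UNIV. f (x i)) = Pi\<^sub>M UNIV (\<lambda>_. density lborel f)"
  proof (rule D.PiM_eqI)
    fix A :: "'n \<Rightarrow> real set" assume A: "\<And>i. i \<in> UNIV \<Longrightarrow> A i \<in> sets (density lborel f)"
    then have [measurable]: "A i \<in> sets borel" for i by simp
    have S: "Pi\<^sub>E UNIV A \<in> sets (Pi\<^sub>M UNIV (\<lambda>_::'n. lborel))"
      by (intro sets_PiM_I_finite) auto
    have "emeasure (density (Pi\<^sub>M UNIV (\<lambda>_::'n. lborel)) (\<lambda>x. \<Prod>i\<in>UNIV. f (x i))) (Pi\<^sub>E UNIV A)
      = (\<integral>\<^sup>+x. (\<Prod>i\<in>UNIV. f (x i)) * indicator (Pi\<^sub>E UNIV A) x \<partial>Pi\<^sub>M UNIV (\<lambda>_. lborel))"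
      by (rule emeasure_density[OF m S])
    also have "\<dots> = (\<integral>\<^sup>+x. (\<Prod>i\<in>UNIV. f (x i) * indicator (A i) (x i)) \<partial>Pi\<^sub>M UNIV (\<lambda>_. lborel))"
    proof (rule nn_integral_cong)
      fix x :: "'n \<Rightarrow> real"
      have "indicator (Pi\<^sub>E UNIV A) x = (\<Prod>i\<in>UNIV. indicator (A i) (x i) :: ennreal)"
        by (auto simp: indicator_def PiE_def Pi_def prod.neutral)
      then show "(\<Prod>i\<in>UNIV. f (x i)) * indicator (Pi\<^sub>E UNIV A) x
        = (\<Prod>i\<in>UNIV. f (x i) * indicator (A i) (x i))"
        by (simp add: prod.distrib)
    qed
    also have "\<dots> = (\<Prod>i\<in>UNIV. \<integral>\<^sup>+x. f x * indicator (A i) x \<partial>lborel)"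
      by (rule L.product_nn_integral_prod) auto
    also have "\<dots> = (\<Prod>i\<in>UNIV. emeasure (density lborel f) (A i))"
      by (simp add: emeasure_density)
    finally show "emeasure (density (Pi\<^sub>M UNIV (\<lambda>_::'n. lborel)) (\<lambda>x. \<Prod>i\<in>UNIV. f (x i))) (Pi\<^sub>E UNIV A)
      = (\<Prod>i\<in>UNIV. emeasure (density lborel f) (A i))" .
  qed (auto intro!: sets_PiM_cong)
  \<comment> \<open>The density is written in terms of the vector built from \<open>x\<close>, the
    form in which it can be pulled out of the image measure.\<close>
  then have "iid_vec (density lborel f) = distr (density (Pi\<^sub>M UNIV (\<lambda>_::'n. lborel)) (\<lambda>x. \<Prod>i\<in>UNIV. f ((\<chi> i. x i) $ i))) borel (\<lambda>f. \<chi> i. f i)"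
    unfolding iid_vec_def by simp
  also have "\<dots> = density (iid_vec lborel) (\<lambda>x::real ^ 'n::finite. \<Prod>i\<in>UNIV. f (x $ i))"
    unfolding iid_vec_def by (rule density_distr[symmetric]) (auto intro: vec_lambda_measurable)
  finally show ?thesis by (simp add: iid_vec_lborel)
qed

lemma gaussian_vec_density:
  assumes "0 < s"
  shows "gaussian_vec s
    = density lborel (\<lambda>x::real ^ 'n::finite. \<Prod>i\<in>UNIV. ennreal (normal_density 0 s (x $ i)))"
  unfolding gaussian_vec_def
  by (intro iid_vec_density prob_space_imp_sigma_finite prob_space_normal_density assms) auto

section \<open>Linear forms of standard Gaussian vectors\<close>

definition std_gaussian :: "real measure" where
  "std_gaussian = density lborel (\<lambda>x. ennreal (std_normal_density x))"

lemma sets_std_gaussian [simp, measurable_cong]: "sets std_gaussian = sets borel"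
  by (simp add: std_gaussian_def)

lemma prob_space_std_gaussian: "prob_space std_gaussian"
  unfolding std_gaussian_def by (rule prob_space_normal_density) simp

lemma nn_integral_std_gaussian:
  assumes [measurable]: "g \<in> borel_measurable borel"
  shows "(\<integral>\<^sup>+x. g x \<partial>std_gaussian) = (\<integral>\<^sup>+x. ennreal (std_normal_density x) * g x \<partial>lborel)"
  unfolding std_gaussian_def by (subst nn_integral_density) auto

lemma nn_integral_normal_density:
  assumes "0 < s"
  shows "(\<integral>\<^sup>+x. ennreal (normal_density m s x) \<partial>lborel) = 1"
  using prob_space.emeasure_space_1[OF prob_space_normal_density[OF assms, of m]]
  by (simp add: emeasure_density)

text \<open>Against the standard density, the factor \<open>exp (c * z\<^sup>2)\<close> only changes
  the variance, to \<open>1 / (1 - 2 * c)\<close>; the value is the ratio of the normalising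
  constants.\<close>

lemma nn_integral_std_gaussian_exp_square:
  assumes "2 * c < 1"
  shows "(\<integral>\<^sup>+z. ennreal (exp (c * z\<^sup>2)) \<partial>std_gaussian) = ennreal (1 / sqrt (1 - 2 * c))"
proof -
  define s where "s = 1 / sqrt (1 - 2 * c)"
  have s: "0 < s" "s\<^sup>2 = 1 / (1 - 2 * c)" using assms by (simp_all add: s_def power_divide)
  have eq: "std_normal_density z * exp (c * z\<^sup>2) = s * normal_density 0 s z" for z
  proof -
    have "- z\<^sup>2 / (2 * s\<^sup>2) = - z\<^sup>2 / 2 + c * z\<^sup>2"
      using assms by (simp add: s field_simps)
    moreover have "sqrt (2 * pi * s\<^sup>2) = sqrt (2 * pi) * s"
      using s(1) by (simp add: real_sqrt_mult)
    ultimately show ?thesis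
      using s(1) by (simp add: normal_density_def exp_add[symmetric])
  qed
  have "(\<integral>\<^sup>+z. ennreal (exp (c * z\<^sup>2)) \<partial>std_gaussian)
    = (\<integral>\<^sup>+z. ennreal s * ennreal (normal_density 0 s z) \<partial>lborel)"
    using s(1) by (subst nn_integral_std_gaussian) (auto simp: ennreal_mult'[symmetric] eq intro!: nn_integral_cong)
  also have "\<dots> = ennreal s"
    using s(1) by (subst nn_integral_cmult) (auto simp: nn_integral_normal_density)
  finally show ?thesis by (simp add: s_def)
qed

section \<open>Rotation invariance of a pair of independent standard Gaussians\<close>

text \<open>The plane rotation is carried out by two substitutions on the line:
  \<open>u = a * x + b * y\<close> replaces \<open>x\<close>, and, after exchanging the integrals,
  \<open>y = b * u + a * v\<close> replaces \<open>y\<close>. Both are invertible as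
  \<open>a\<close> is nonzero, and their Jacobians \<open>1 / a\<close> and \<open>a\<close>
  cancel.\<close>

lemma std_gaussian_pair_rotation_aux:
  fixes h :: "real \<times> real \<Rightarrow> ennreal"
  assumes ab: "a\<^sup>2 + b\<^sup>2 = 1" and "a \<noteq> 0" and [measurable]: "h \<in> borel_measurable borel"
  shows "(\<integral>\<^sup>+y. \<integral>\<^sup>+x. h (a * x + b * y, a * y - b * x) \<partial>std_gaussian \<partial>std_gaussian)
    = (\<integral>\<^sup>+y. \<integral>\<^sup>+x. h (x, y) \<partial>std_gaussian \<partial>std_gaussian)"
proof -
  let ?\<phi> = "\<lambda>x. ennreal (std_normal_density x)"
  have [measurable]: "h \<in> borel_measurable (borel \<Otimes>\<^sub>M borel)" by (simp add: borel_prod)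
  \<comment> \<open>The product density depends only on the Euclidean norm, which the inverse
    rotation preserves.\<close>
  have id: "std_normal_density (a * u - b * v) * std_normal_density (b * u + a * v)
    = std_normal_density u * std_normal_density v" for u v
  proof -
    have "(a * u - b * v)\<^sup>2 + (b * u + a * v)\<^sup>2 = (a\<^sup>2 + b\<^sup>2) * (u\<^sup>2 + v\<^sup>2)" by algebra
    then have e: "- (a * u - b * v)\<^sup>2 / 2 + - (b * u + a * v)\<^sup>2 / 2 = - u\<^sup>2 / 2 + - v\<^sup>2 / 2"
      by (simp add: ab)
    show ?thesis
      unfolding normal_density_def using e by (simp add: exp_add[symmetric])
  qed
  have "(\<integral>\<^sup>+y. \<integral>\<^sup>+x. h (a * x + b * y, a * y - b * x) \<partial>std_gaussian \<partial>std_gaussian)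
    = (\<integral>\<^sup>+y. ?\<phi> y * (\<integral>\<^sup>+x. ?\<phi> x * h (a * x + b * y, a * y - b * x) \<partial>lborel) \<partial>lborel)"
    by (simp add: nn_integral_std_gaussian)
  also have "\<dots> = (\<integral>\<^sup>+y. \<integral>\<^sup>+x. ?\<phi> y * (?\<phi> x * h (a * x + b * y, a * y - b * x)) \<partial>lborel \<partial>lborel)"
    by (intro nn_integral_cong nn_integral_cmult[symmetric]) measurable
  also have "\<dots> = (\<integral>\<^sup>+y. ennreal \<bar>1 / a\<bar> * (\<integral>\<^sup>+u. ?\<phi> y * (?\<phi> ((u - b * y) / a) * h (u, (y - b * u) / a)) \<partial>lborel) \<partial>lborel)"
  proof (rule nn_integral_cong)
    fix y :: real
    have "a * (- b * y / a + 1 / a * u) + b * y = u" for u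
      using \<open>a \<noteq> 0\<close> by (simp add: field_simps)
    moreover have "a * y - b * (- b * y / a + 1 / a * u) = (y - b * u) / a" for u
    proof -
      have "a * y - b * (- b * y / a + 1 / a * u) = ((a\<^sup>2 + b\<^sup>2) * y - b * u) / a"
        using \<open>a \<noteq> 0\<close> by (simp add: field_simps power2_eq_square)
      then show ?thesis by (simp add: ab)
    qed
    moreover have "- b * y / a + 1 / a * u = (u - b * y) / a" for u
      using \<open>a \<noteq> 0\<close> by (simp add: field_simps)
    ultimately show "(\<integral>\<^sup>+x. ?\<phi> y * (?\<phi> x * h (a * x + b * y, a * y - b * x)) \<partial>lborel)
      = ennreal \<bar>1 / a\<bar> * (\<integral>\<^sup>+u. ?\<phi> y * (?\<phi> ((u - b * y) / a) * h (u, (y - b * u) / a)) \<partial>lborel)"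
      using \<open>a \<noteq> 0\<close>
      by (subst nn_integral_real_affine[where c = "1 / a" and t = "- b * y / a"]) simp_all
  qed
  also have "\<dots> = (\<integral>\<^sup>+y. \<integral>\<^sup>+u. ennreal \<bar>1 / a\<bar> * (?\<phi> y * (?\<phi> ((u - b * y) / a) * h (u, (y - b * u) / a))) \<partial>lborel \<partial>lborel)"
    by (intro nn_integral_cong nn_integral_cmult[symmetric]) measurable
  also have "\<dots> = (\<integral>\<^sup>+u. \<integral>\<^sup>+y. ennreal \<bar>1 / a\<bar> * (?\<phi> y * (?\<phi> ((u - b * y) / a) * h (u, (y - b * u) / a))) \<partial>lborel \<partial>lborel)"
    by (rule lborel_pair.Fubini') measurable
  also have "\<dots> = (\<integral>\<^sup>+u. \<integral>\<^sup>+v. ?\<phi> u * (?\<phi> v * h (u, v)) \<partial>lborel \<partial>lborel)"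
  proof (rule nn_integral_cong)
    fix u :: real
    have 1: "((b * u + a * v) - b * u) / a = v" for v using \<open>a \<noteq> 0\<close> by simp
    have 2: "(u - b * (b * u + a * v)) / a = a * u - b * v" for v
    proof -
      have "u - b * (b * u + a * v) = (a\<^sup>2 + b\<^sup>2) * u - b * (b * u + a * v)" by (simp add: ab)
      also have "\<dots> = a * (a * u - b * v)" by algebra
      finally show ?thesis using \<open>a \<noteq> 0\<close> by simp
    qed
    have "ennreal \<bar>a\<bar> * (\<integral>\<^sup>+v. ennreal \<bar>1 / a\<bar> * (?\<phi> (b * u + a * v) * (?\<phi> (a * u - b * v) * h (u, v))) \<partial>lborel)
        = (\<integral>\<^sup>+v. ennreal \<bar>a\<bar> * (ennreal \<bar>1 / a\<bar> * (?\<phi> (b * u + a * v) * (?\<phi> (a * u - b * v) * h (u, v)))) \<partial>lborel)"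
      by (rule nn_integral_cmult[symmetric]) measurable
    also have "\<dots> = (\<integral>\<^sup>+v. ?\<phi> u * (?\<phi> v * h (u, v)) \<partial>lborel)"
    proof (rule nn_integral_cong)
      fix v :: real
      have "ennreal \<bar>a\<bar> * ennreal \<bar>1 / a\<bar> = 1"
        using \<open>a \<noteq> 0\<close> by (simp add: ennreal_mult'[symmetric])
      moreover have "?\<phi> (b * u + a * v) * ?\<phi> (a * u - b * v) = ?\<phi> u * ?\<phi> v"
        using id[of u v] by (simp add: ennreal_mult'[symmetric] mult.commute)
      ultimately show "ennreal \<bar>a\<bar> * (ennreal \<bar>1 / a\<bar> * (?\<phi> (b * u + a * v) * (?\<phi> (a * u - b * v) * h (u, v))))
        = ?\<phi> u * (?\<phi> v * h (u, v))"
        by (metis mult.assoc mult_1)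
    qed
    finally show "(\<integral>\<^sup>+y. ennreal \<bar>1 / a\<bar> * (?\<phi> y * (?\<phi> ((u - b * y) / a) * h (u, (y - b * u) / a))) \<partial>lborel)
      = (\<integral>\<^sup>+v. ?\<phi> u * (?\<phi> v * h (u, v)) \<partial>lborel)"
      using \<open>a \<noteq> 0\<close>
      by (subst nn_integral_real_affine[where c = a and t = "b * u"]) (simp_all only: 1 2, measurable)
  qed
  also have "\<dots> = (\<integral>\<^sup>+v. \<integral>\<^sup>+u. ?\<phi> u * (?\<phi> v * h (u, v)) \<partial>lborel \<partial>lborel)"
    by (rule lborel_pair.Fubini') measurable
  also have "\<dots> = (\<integral>\<^sup>+v. \<integral>\<^sup>+u. ?\<phi> v * (?\<phi> u * h (u, v)) \<partial>lborel \<partial>lborel)"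
    by (simp only: mult.left_commute)
  also have "\<dots> = (\<integral>\<^sup>+v. ?\<phi> v * (\<integral>\<^sup>+u. ?\<phi> u * h (u, v) \<partial>lborel) \<partial>lborel)"
    by (intro nn_integral_cong nn_integral_cmult) measurable
  also have "\<dots> = (\<integral>\<^sup>+y. \<integral>\<^sup>+x. h (x, y) \<partial>std_gaussian \<partial>std_gaussian)"
    by (simp add: nn_integral_std_gaussian)
  finally show ?thesis .
qed

lemma std_gaussian_pair_rotation:
  fixes h :: "real \<times> real \<Rightarrow> ennreal"
  assumes ab: "a\<^sup>2 + b\<^sup>2 = 1" and [measurable]: "h \<in> borel_measurable borel"
  shows "(\<integral>\<^sup>+y. \<integral>\<^sup>+x. h (a * x + b * y, a * y - b * x) \<partial>std_gaussian \<partial>std_gaussian)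
    = (\<integral>\<^sup>+y. \<integral>\<^sup>+x. h (x, y) \<partial>std_gaussian \<partial>std_gaussian)"
proof (cases "a = 0")
  case False
  with assms show ?thesis by (intro std_gaussian_pair_rotation_aux)
next
  case True
  then have b: "b\<^sup>2 = 1" using ab by simp
  \<comment> \<open>a quarter turn is the square of an eighth turn\<close>
  let ?c = "1 / sqrt 2" and ?d = "b / sqrt 2"
  have cd: "?c\<^sup>2 + ?d\<^sup>2 = 1" "?c \<noteq> 0" by (simp_all add: power_divide b)
  define g where "g = (\<lambda>z. h (?c * fst z + ?d * snd z, ?c * snd z - ?d * fst z))"
  have [measurable]: "g \<in> borel_measurable borel"
    unfolding g_def by (simp add: borel_prod[symmetric])
  have bb: "b * b = 1" using b by (simp add: power2_eq_square)
  have e: "h (a * x + b * y, a * y - b * x) = g (?c * x + ?d * y, ?c * y - ?d * x)" for x y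
  proof -
    have "?c * (?c * x + ?d * y) + ?d * (?c * y - ?d * x) = (x - b * b * x) / 2 + b * y"
      by (simp add: field_simps)
    moreover have "?c * (?c * y - ?d * x) - ?d * (?c * x + ?d * y) = (y - b * b * y) / 2 - b * x"
      by (simp add: field_simps)
    ultimately show ?thesis by (simp add: g_def True bb)
  qed
  show ?thesis
    unfolding e
    by (subst std_gaussian_pair_rotation_aux[OF cd \<open>g \<in> _\<close>])
      (simp add: g_def std_gaussian_pair_rotation_aux[OF cd \<open>h \<in> _\<close>, simplified])
qed

text \<open>A rotation followed by scaling with \<open>r = sqrt (a\<^sup>2 + b\<^sup>2)\<close>. For
  an \<open>h\<close> that looks only at its first argument, this says that
  \<open>a * x + b * y\<close> is distributed as \<open>r * x\<close>.\<close>

lemma std_gaussian_linear_combination: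
  fixes h :: "real \<times> real \<Rightarrow> ennreal"
  assumes [measurable]: "h \<in> borel_measurable borel"
  shows "(\<integral>\<^sup>+y. \<integral>\<^sup>+x. h (a * x + b * y, a * y - b * x) \<partial>std_gaussian \<partial>std_gaussian)
    = (\<integral>\<^sup>+y. \<integral>\<^sup>+x. h (sqrt (a\<^sup>2 + b\<^sup>2) * x, sqrt (a\<^sup>2 + b\<^sup>2) * y) \<partial>std_gaussian \<partial>std_gaussian)"
proof (cases "a\<^sup>2 + b\<^sup>2 = 0")
  case True
  then have "a = 0" "b = 0" by (simp_all add: sum_power2_eq_zero_iff)
  then show ?thesis by simp
next
  case False
  define r where "r = sqrt (a\<^sup>2 + b\<^sup>2)"
  have r: "r \<noteq> 0" "r\<^sup>2 = a\<^sup>2 + b\<^sup>2"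
    using False by (auto simp: r_def)
  have "(a / r)\<^sup>2 + (b / r)\<^sup>2 = 1"
    using r(1) by (simp add: power_divide add_divide_distrib[symmetric] flip: r(2))
  moreover have "(\<lambda>z. h (r * fst z, r * snd z)) \<in> borel_measurable borel"
    by (simp add: borel_prod[symmetric])
  ultimately have "(\<integral>\<^sup>+y. \<integral>\<^sup>+x. h (r * (a / r * x + b / r * y), r * (a / r * y - b / r * x)) \<partial>std_gaussian \<partial>std_gaussian)
    = (\<integral>\<^sup>+y. \<integral>\<^sup>+x. h (r * x, r * y) \<partial>std_gaussian \<partial>std_gaussian)"
    using std_gaussian_pair_rotation[of "a / r" "b / r" "\<lambda>z. h (r * fst z, r * snd z)"] by simp
  moreover have "r * (a / r * x + b / r * y) = a * x + b * y" "r * (a / r * y - b / r * x) = a * y - b * x" for x y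
    using r by (simp_all add: field_simps)
  ultimately show ?thesis by (simp add: r_def)
qed

text \<open>Triangular representation: the image of the standard Gaussian under two linear forms depends
  only on their Gram matrix, here factorised as in Cholesky's decomposition.\<close>

lemma std_gaussian_two_forms:
  fixes c d :: "'i \<Rightarrow> real"
  assumes "finite I"
  shows "\<exists>u v w. u\<^sup>2 = (\<Sum>i\<in>I. (c i)\<^sup>2) \<and> u * v = (\<Sum>i\<in>I. c i * d i) \<and> v\<^sup>2 + w\<^sup>2 = (\<Sum>i\<in>I. (d i)\<^sup>2) \<and>
    (\<forall>h :: real \<times> real \<Rightarrow> ennreal. h \<in> borel_measurable borel \<longrightarrow>
      (\<integral>\<^sup>+x. h (\<Sum>i\<in>I. c i * x i, \<Sum>i\<in>I. d i * x i) \<partial>Pi\<^sub>M I (\<lambda>_. std_gaussian))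
      = (\<integral>\<^sup>+y. \<integral>\<^sup>+x. h (u * x, v * x + w * y) \<partial>std_gaussian \<partial>std_gaussian))"
  using assms
proof (induction I rule: finite_induct)
  case empty
  interpret prob_space std_gaussian by (rule prob_space_std_gaussian)
  show ?case
    by (intro exI[of _ 0]) (simp add: PiM_empty nn_integral_count_space_finite emeasure_space_1)
next
  case (insert i I)
  interpret G: prob_space std_gaussian by (rule prob_space_std_gaussian)
  interpret GG: pair_prob_space std_gaussian std_gaussian ..
  interpret product_sigma_finite "\<lambda>_::'i. std_gaussian"
    by (simp add: product_sigma_finite_def G.sigma_finite_measure_axioms)
  obtain u v w where uvw: "u\<^sup>2 = (\<Sum>i\<in>I. (c i)\<^sup>2)" "u * v = (\<Sum>i\<in>I. c i * d i)"
      "v\<^sup>2 + w\<^sup>2 = (\<Sum>i\<in>I. (d i)\<^sup>2)"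
    and IH: "\<And>h :: real \<times> real \<Rightarrow> ennreal. h \<in> borel_measurable borel \<Longrightarrow>
      (\<integral>\<^sup>+x. h (\<Sum>i\<in>I. c i * x i, \<Sum>i\<in>I. d i * x i) \<partial>Pi\<^sub>M I (\<lambda>_. std_gaussian))
      = (\<integral>\<^sup>+y. \<integral>\<^sup>+x. h (u * x, v * x + w * y) \<partial>std_gaussian \<partial>std_gaussian)"
    using insert.IH by blast
  \<comment> \<open>if the first form vanishes, any rotation will do\<close>
  define r where "r = sqrt (u\<^sup>2 + (c i)\<^sup>2)"
  have r2: "r\<^sup>2 = u\<^sup>2 + (c i)\<^sup>2" by (simp add: r_def)
  obtain k s where ks: "k\<^sup>2 + s\<^sup>2 = 1" "u = r * k" "c i = r * s"
  proof (cases "r = 0")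
    case True
    then have "u = 0" "c i = 0" using r2 by (simp_all add: sum_power2_eq_zero_iff)
    with True show ?thesis by (intro that[of 1 0]) simp_all
  next
    case False
    then show ?thesis
      by (intro that[of "u / r" "c i / r"]) (simp_all add: power_divide add_divide_distrib[symmetric] flip: r2)
  qed
  \<comment> \<open>The pair \<open>(u, c i)\<close> is \<open>r\<close> times the unit vector
    \<open>(k, s)\<close>. Rotating by it puts all of the first form on one variable;
    \<open>v'\<close> and \<open>e\<close> are the components of \<open>(v, d i)\<close> along and
    across \<open>(k, s)\<close>.\<close>
  define v' where "v' = v * k + d i * s"
  define e where "e = d i * k - v * s"
  define w' where "w' = sqrt (e\<^sup>2 + w\<^sup>2)"
  have w'2: "w'\<^sup>2 = e\<^sup>2 + w\<^sup>2" by (simp add: w'_def)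
  have ve: "v'\<^sup>2 + e\<^sup>2 = v\<^sup>2 + (d i)\<^sup>2"
  proof -
    have "v'\<^sup>2 + e\<^sup>2 = (k\<^sup>2 + s\<^sup>2) * (v\<^sup>2 + (d i)\<^sup>2)" unfolding v'_def e_def by algebra
    then show ?thesis by (simp add: ks)
  qed
  have main: "(\<integral>\<^sup>+x. h (\<Sum>j\<in>insert i I. c j * x j, \<Sum>j\<in>insert i I. d j * x j) \<partial>Pi\<^sub>M (insert i I) (\<lambda>_. std_gaussian))
      = (\<integral>\<^sup>+y. \<integral>\<^sup>+x. h (r * x, v' * x + w' * y) \<partial>std_gaussian \<partial>std_gaussian)"
    if [measurable]: "h \<in> borel_measurable borel" for h :: "real \<times> real \<Rightarrow> ennreal"
  proof -
    have [measurable]: "h \<in> borel_measurable (borel \<Otimes>\<^sub>M borel)" by (simp add: borel_prod)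
    have 1: "(\<integral>\<^sup>+x. h (\<Sum>j\<in>insert i I. c j * x j, \<Sum>j\<in>insert i I. d j * x j) \<partial>Pi\<^sub>M (insert i I) (\<lambda>_. std_gaussian))
      = (\<integral>\<^sup>+z. \<integral>\<^sup>+x. h (\<Sum>j\<in>insert i I. c j * (x(i := z)) j, \<Sum>j\<in>insert i I. d j * (x(i := z)) j)
          \<partial>Pi\<^sub>M I (\<lambda>_. std_gaussian) \<partial>std_gaussian)"
      by (rule product_nn_integral_insert_rev) (use insert.hyps in \<open>simp_all, measurable\<close>)
    also have "\<dots> = (\<integral>\<^sup>+z. \<integral>\<^sup>+x. h (c i * z + (\<Sum>j\<in>I. c j * x j), d i * z + (\<Sum>j\<in>I. d j * x j))
          \<partial>Pi\<^sub>M I (\<lambda>_. std_gaussian) \<partial>std_gaussian)"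
    proof -
      have "(\<Sum>j\<in>I. f j * (x(i := z)) j) = (\<Sum>j\<in>I. f j * x j)" for f x :: "'i \<Rightarrow> real" and z
        using insert.hyps by (intro sum.cong) auto
      then show ?thesis using insert.hyps by simp
    qed
    also have "\<dots> = (\<integral>\<^sup>+z. \<integral>\<^sup>+y. \<integral>\<^sup>+x. h (c i * z + u * x, d i * z + (v * x + w * y)) \<partial>std_gaussian \<partial>std_gaussian \<partial>std_gaussian)"
    proof (rule nn_integral_cong)
      fix z
      have "(\<lambda>q. h (c i * z + fst q, d i * z + snd q)) \<in> borel_measurable borel"
        by (simp add: borel_prod[symmetric])
      from IH[OF this] show "(\<integral>\<^sup>+x. h (c i * z + (\<Sum>j\<in>I. c j * x j), d i * z + (\<Sum>j\<in>I. d j * x j)) \<partial>Pi\<^sub>M I (\<lambda>_. std_gaussian))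
        = (\<integral>\<^sup>+y. \<integral>\<^sup>+x. h (c i * z + u * x, d i * z + (v * x + w * y)) \<partial>std_gaussian \<partial>std_gaussian)"
        by simp
    qed
    also have "\<dots> = (\<integral>\<^sup>+y. \<integral>\<^sup>+z. \<integral>\<^sup>+x. h (c i * z + u * x, d i * z + (v * x + w * y)) \<partial>std_gaussian \<partial>std_gaussian \<partial>std_gaussian)"
      by (rule GG.Fubini') measurable
    also have "\<dots> = (\<integral>\<^sup>+y. \<integral>\<^sup>+z. \<integral>\<^sup>+x. h (r * x, v' * x + (e * z + w * y)) \<partial>std_gaussian \<partial>std_gaussian \<partial>std_gaussian)"
    proof (rule nn_integral_cong)
      fix y
      have "(\<lambda>q. h (r * fst q, v' * fst q + (e * snd q + w * y))) \<in> borel_measurable borel"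
        by (simp add: borel_prod[symmetric])
      from std_gaussian_pair_rotation[OF ks(1) this]
      have "(\<integral>\<^sup>+z. \<integral>\<^sup>+x. h (r * (k * x + s * z), v' * (k * x + s * z) + (e * (k * z - s * x) + w * y)) \<partial>std_gaussian \<partial>std_gaussian)
        = (\<integral>\<^sup>+z. \<integral>\<^sup>+x. h (r * x, v' * x + (e * z + w * y)) \<partial>std_gaussian \<partial>std_gaussian)" by simp
      moreover have "r * (k * x + s * z) = c i * z + u * x" for x z by (simp add: ks algebra_simps)
      moreover have "v' * (k * x + s * z) + (e * (k * z - s * x) + w * y) = d i * z + (v * x + w * y)" for x z
      proof -
        have "v' * (k * x + s * z) + e * (k * z - s * x) = (k\<^sup>2 + s\<^sup>2) * (d i * z + v * x)"
          unfolding v'_def e_def by algebra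
        then show ?thesis by (simp add: ks(1))
      qed
      ultimately show "(\<integral>\<^sup>+z. \<integral>\<^sup>+x. h (c i * z + u * x, d i * z + (v * x + w * y)) \<partial>std_gaussian \<partial>std_gaussian)
        = (\<integral>\<^sup>+z. \<integral>\<^sup>+x. h (r * x, v' * x + (e * z + w * y)) \<partial>std_gaussian \<partial>std_gaussian)"
        by simp
    qed
    also have "\<dots> = (\<integral>\<^sup>+y. \<integral>\<^sup>+z. \<integral>\<^sup>+x. h (r * x, v' * x + w' * z) \<partial>std_gaussian \<partial>std_gaussian \<partial>std_gaussian)"
    proof -
      \<comment> \<open>The second form still carries two independent terms \<open>e * z\<close> and
        \<open>w * y\<close>. As \<open>H\<close> reads only their sum, they merge into the single
        term \<open>w' * z\<close>, which restores the triangular shape.\<close>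
      define H where "H = (\<lambda>q::real \<times> real. \<integral>\<^sup>+x. h (r * x, v' * x + fst q) \<partial>std_gaussian)"
      have "H \<in> borel_measurable (borel \<Otimes>\<^sub>M borel)"
        unfolding H_def by measurable
      then have "H \<in> borel_measurable borel" by (simp add: borel_prod)
      from std_gaussian_linear_combination[OF this, of e w] show ?thesis
        by (simp add: H_def w'_def)
    qed
    also have "\<dots> = (\<integral>\<^sup>+z. \<integral>\<^sup>+x. h (r * x, v' * x + w' * z) \<partial>std_gaussian \<partial>std_gaussian)"
      by (simp add: G.emeasure_space_1)
    finally show ?thesis .
  qed
  have "r * v' = u * v + c i * d i"
    unfolding v'_def using ks by (simp add: algebra_simps)
  moreover have "v'\<^sup>2 + w'\<^sup>2 = v\<^sup>2 + w\<^sup>2 + (d i)\<^sup>2" using ve w'2 by simp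
  ultimately show ?case
    using main r2 uvw insert.hyps by (intro exI[of _ r] exI[of _ v'] exI[of _ w']) auto
qed

section \<open>Second moments of likelihood ratios\<close>

lemma gaussian_vec_1: "gaussian_vec 1 = iid_vec std_gaussian"
  by (simp add: gaussian_vec_def std_gaussian_def)

text \<open>Orthogonal linear forms of a standard Gaussian vector are independent.\<close>

lemma gaussian_vec_exp_orthogonal_squares:
  fixes x1 x2 :: "real ^ 'p::finite"
  assumes orth: "x1 \<bullet> x2 = 0" and "x1 \<noteq> 0"
    and A: "2 * A * (norm x1)\<^sup>2 < 1" and B: "0 \<le> B"
  shows "(\<integral>\<^sup>+x. ennreal (exp (A * (x \<bullet> x1)\<^sup>2 - B * (x \<bullet> x2)\<^sup>2)) \<partial>gaussian_vec 1)
    = ennreal (1 / sqrt ((1 - 2 * A * (norm x1)\<^sup>2) * (1 + 2 * B * (norm x2)\<^sup>2)))"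
proof -
  obtain u v w where uvw: "u\<^sup>2 = (\<Sum>i\<in>UNIV. (x1 $ i)\<^sup>2)" "u * v = (\<Sum>i\<in>UNIV. x1 $ i * x2 $ i)"
      "v\<^sup>2 + w\<^sup>2 = (\<Sum>i\<in>UNIV. (x2 $ i)\<^sup>2)"
    and I: "\<And>h :: real \<times> real \<Rightarrow> ennreal. h \<in> borel_measurable borel \<Longrightarrow>
      (\<integral>\<^sup>+x. h (\<Sum>i\<in>UNIV. x1 $ i * x i, \<Sum>i\<in>UNIV. x2 $ i * x i) \<partial>Pi\<^sub>M UNIV (\<lambda>_. std_gaussian))
      = (\<integral>\<^sup>+y. \<integral>\<^sup>+x. h (u * x, v * x + w * y) \<partial>std_gaussian \<partial>std_gaussian)"
    using std_gaussian_two_forms[of "UNIV :: 'p set" "\<lambda>i. x1 $ i" "\<lambda>i. x2 $ i"] by auto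
  have n: "(norm x)\<^sup>2 = (\<Sum>i\<in>UNIV. (x $ i)\<^sup>2)" for x :: "real ^ 'p"
    unfolding power2_norm_eq_inner by (simp add: inner_vec_def power2_eq_square)
  have u: "u\<^sup>2 = (norm x1)\<^sup>2" by (simp add: n uvw)
  have "u * v = x1 \<bullet> x2" by (simp add: inner_vec_def uvw)
  \<comment> \<open>Since \<open>u\<close> is nonzero, orthogonality removes the off-diagonal
    coefficient. The forms become \<open>u * x\<close> and \<open>w * y\<close> with independent
    \<open>x\<close> and \<open>y\<close>, so the integral splits.\<close>
  then have v: "v = 0" using u orth \<open>x1 \<noteq> 0\<close> by auto
  have bnn: "0 \<le> 1 + B * 2 * (norm x2)\<^sup>2" "- 1 < 2 * (B * (norm x2)\<^sup>2)"
    using mult_nonneg_nonneg[OF B zero_le_power2[of "norm x2"]] by (simp, linarith)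
  have w: "w\<^sup>2 = (norm x2)\<^sup>2" using uvw(3) v by (simp add: n)
  define h where "h = (\<lambda>q::real \<times> real. ennreal (exp (A * (fst q)\<^sup>2 - B * (snd q)\<^sup>2)))"
  have h: "h \<in> borel_measurable borel" unfolding h_def by (simp add: borel_prod[symmetric])
  have "(\<integral>\<^sup>+x. ennreal (exp (A * (x \<bullet> x1)\<^sup>2 - B * (x \<bullet> x2)\<^sup>2)) \<partial>gaussian_vec 1)
      = (\<integral>\<^sup>+x. h (\<Sum>i\<in>UNIV. x1 $ i * x i, \<Sum>i\<in>UNIV. x2 $ i * x i) \<partial>Pi\<^sub>M UNIV (\<lambda>_. std_gaussian))"
    unfolding gaussian_vec_1
    by (subst nn_integral_iid_vec)
      (auto simp: h_def inner_vec_def mult.commute intro!: borel_measurable_continuous_onI continuous_intros)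
  also have "\<dots> = (\<integral>\<^sup>+y. \<integral>\<^sup>+x. h (u * x, v * x + w * y) \<partial>std_gaussian \<partial>std_gaussian)"
    by (rule I[OF h])
  also have "\<dots> = (\<integral>\<^sup>+y. \<integral>\<^sup>+x. ennreal (exp (- (B * w\<^sup>2) * y\<^sup>2)) * ennreal (exp (A * u\<^sup>2 * x\<^sup>2)) \<partial>std_gaussian \<partial>std_gaussian)"
    by (simp add: h_def v power_mult_distrib ennreal_mult'[symmetric] exp_add[symmetric] algebra_simps)
  also have "\<dots> = (\<integral>\<^sup>+y. ennreal (exp (- (B * w\<^sup>2) * y\<^sup>2)) \<partial>std_gaussian) * (\<integral>\<^sup>+x. ennreal (exp (A * u\<^sup>2 * x\<^sup>2)) \<partial>std_gaussian)"
    by (simp add: nn_integral_cmult nn_integral_multc)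
  also have "\<dots> = ennreal (1 / sqrt (1 + 2 * B * (norm x2)\<^sup>2)) * ennreal (1 / sqrt (1 - 2 * A * (norm x1)\<^sup>2))"
    using A bnn
    by (subst (1 2) nn_integral_std_gaussian_exp_square) (simp_all add: u w mult.assoc add_nonneg_nonneg)
  also have "\<dots> = ennreal (1 / sqrt ((1 - 2 * A * (norm x1)\<^sup>2) * (1 + 2 * B * (norm x2)\<^sup>2)))"
    by (subst ennreal_mult'[symmetric]) (use A bnn in \<open>auto simp: real_sqrt_mult mult.commute\<close>)
  finally show ?thesis .
qed

section \<open>The likelihood product for a single row\<close>

text \<open>Completing the square in \<open>y\<close> turns the integrand into a multiple of a
  normal density with mean \<open>(u + v) / (2 - s\<^sup>2)\<close> and variance
  \<open>s\<^sup>2 / (2 - s\<^sup>2)\<close>. The remaining exponent is arranged by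
  \<open>u + v\<close> and \<open>u - v\<close> because these will be orthogonal linear forms of the
  row.\<close>

lemma nn_integral_normal_likelihood_product:
  fixes s u v :: real
  assumes s: "0 < s" "s < 1"
  shows "(\<integral>\<^sup>+y. ennreal (normal_density 0 s (y - u) / std_normal_density y *
      (normal_density 0 s (y - v) / std_normal_density y)) \<partial>std_gaussian)
    = ennreal (1 / (s * sqrt (2 - s\<^sup>2)) *
        exp (1 / (4 * (2 - s\<^sup>2)) * (u + v)\<^sup>2 - 1 / (4 * s\<^sup>2) * (u - v)\<^sup>2))"
proof -
  have s2: "s\<^sup>2 < 1" using s by (simp add: power_less_one_iff abs_square_less_1)
  define t where "t = s / sqrt (2 - s\<^sup>2)"
  have t: "0 < t" "t\<^sup>2 = s\<^sup>2 / (2 - s\<^sup>2)" using s s2 by (simp_all add: t_def power_divide)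
  define m where "m = (u + v) / (2 - s\<^sup>2)"
  define C where "C = 1 / (s * sqrt (2 - s\<^sup>2)) * exp (1 / (4 * (2 - s\<^sup>2)) * (u + v)\<^sup>2 - 1 / (4 * s\<^sup>2) * (u - v)\<^sup>2)"
  have C: "0 \<le> C" using s s2 by (simp add: C_def)
  have eq: "std_normal_density y * (normal_density 0 s (y - u) / std_normal_density y *
      (normal_density 0 s (y - v) / std_normal_density y)) = C * normal_density m t y" for y
  proof -
    define S where "S = s\<^sup>2"
    have S: "0 < S" "S < 1" using s s2 by (auto simp: S_def)
    have e: "- (y - u)\<^sup>2 / (2 * S) + - (y - v)\<^sup>2 / (2 * S) - (- y\<^sup>2 / 2)
      = (1 / (4 * (2 - S)) * (u + v)\<^sup>2 - 1 / (4 * S) * (u - v)\<^sup>2) + - (y - m)\<^sup>2 / (2 * (S / (2 - S)))"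
    proof -
      have "y - m = ((2 - S) * y - (u + v)) / (2 - S)"
        using S by (simp add: m_def S_def[symmetric] field_simps)
      then have "(y - m)\<^sup>2 / (2 * (S / (2 - S))) = ((2 - S) * y - (u + v))\<^sup>2 / (2 * S * (2 - S))"
        using S by (simp add: power_divide power2_eq_square)
      moreover have "(y - u)\<^sup>2 / (2 * S) + (y - v)\<^sup>2 / (2 * S) - y\<^sup>2 / 2
          + (1 / (4 * (2 - S)) * (u + v)\<^sup>2 - 1 / (4 * S) * (u - v)\<^sup>2)
        = ((2 - S) * y - (u + v))\<^sup>2 / (2 * S * (2 - S))"
      proof -
        \<comment> \<open>Over the common denominator \<open>4 * (S * Q)\<close> the claim is a
          polynomial identity in the numerators.\<close>
        define Q where "Q = 2 - S"
        have "Q \<noteq> 0" "S \<noteq> 0" using S by (simp_all add: Q_def)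
        then have "(y - u)\<^sup>2 / (2 * S) = 2 * Q * (y - u)\<^sup>2 / (4 * (S * Q))"
          "(y - v)\<^sup>2 / (2 * S) = 2 * Q * (y - v)\<^sup>2 / (4 * (S * Q))"
          "y\<^sup>2 / 2 = 2 * S * Q * y\<^sup>2 / (4 * (S * Q))"
          "1 / (4 * Q) * (u + v)\<^sup>2 = S * (u + v)\<^sup>2 / (4 * (S * Q))"
          "1 / (4 * S) * (u - v)\<^sup>2 = Q * (u - v)\<^sup>2 / (4 * (S * Q))"
          "(Q * y - (u + v))\<^sup>2 / (2 * S * Q) = 2 * (Q * y - (u + v))\<^sup>2 / (4 * (S * Q))"
          by simp_all
        moreover have "2 * Q * (y - u)\<^sup>2 + 2 * Q * (y - v)\<^sup>2 - 2 * S * Q * y\<^sup>2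
            + (S * (u + v)\<^sup>2 - Q * (u - v)\<^sup>2) = 2 * (Q * y - (u + v))\<^sup>2"
          by (simp add: Q_def power2_eq_square algebra_simps)
        ultimately show ?thesis
          unfolding Q_def[symmetric]
          by (simp only: add_divide_distrib[symmetric] diff_divide_distrib[symmetric])
      qed
      ultimately show ?thesis by simp
    qed
    have c: "1 / sqrt (2 * pi * S) * (1 / sqrt (2 * pi * S)) / (1 / sqrt (2 * pi))
      = 1 / (s * sqrt (2 - S)) * (1 / sqrt (2 * pi * (S / (2 - S))))"
    proof -
      have ss: "sqrt S = s" using s by (simp add: S_def)
      have q: "sqrt (2 - S) \<noteq> 0" using S by simp
      have p: "sqrt (2 * pi) * sqrt (2 * pi) = 2 * pi" by simp
      show ?thesis using s q
        by (simp add: real_sqrt_mult real_sqrt_divide ss field_simps)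
    qed
    have pos: "std_normal_density y > 0" by (rule normal_density_pos) simp
    have "std_normal_density y * (normal_density 0 s (y - u) / std_normal_density y *
      (normal_density 0 s (y - v) / std_normal_density y))
      = normal_density 0 s (y - u) * normal_density 0 s (y - v) / std_normal_density y"
      using pos by (simp add: field_simps)
    also have "\<dots> = (1 / sqrt (2 * pi * S) * (1 / sqrt (2 * pi * S)) / (1 / sqrt (2 * pi))) *
      exp (- (y - u)\<^sup>2 / (2 * S) + - (y - v)\<^sup>2 / (2 * S) - (- y\<^sup>2 / 2))"
      unfolding normal_density_def S_def[symmetric] exp_add exp_diff by simp
    also have "\<dots> = C * normal_density m t y"
      unfolding c e unfolding C_def normal_density_def t S_def[symmetric] exp_add by simp
    finally show ?thesis .
  qed
  have "(\<integral>\<^sup>+y. ennreal (normal_density 0 s (y - u) / std_normal_density y *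
      (normal_density 0 s (y - v) / std_normal_density y)) \<partial>std_gaussian)
    = (\<integral>\<^sup>+y. ennreal C * ennreal (normal_density m t y) \<partial>lborel)"
    by (subst nn_integral_std_gaussian)
      (measurable, simp only: ennreal_mult'[symmetric] eq C normal_density_nonneg)
  also have "\<dots> = ennreal C"
    using t by (subst nn_integral_cmult) (auto simp: nn_integral_normal_density)
  finally show ?thesis by (simp add: C_def)
qed

text \<open>Equal norms make \<open>b1 + b2\<close> and \<open>b1 - b2\<close> orthogonal. The two
  Gaussian factors are then \<open>(1 - r) / (2 - s\<^sup>2)\<close> and
  \<open>(1 - r) / s\<^sup>2\<close> with \<open>r = b1 \<bullet> b2\<close>, so the dependence on
  \<open>s\<close> cancels against the constant from the integral over \<open>y\<close>. The bound
  \<open>r < 1\<close> makes the integral finite; \<open>0 \<le> r\<close> excludes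
  \<open>b2 = - b1\<close>.\<close>

lemma nn_integral_row_likelihood_product:
  fixes b1 b2 :: "real ^ 'p::finite"
  assumes n: "(norm b1)\<^sup>2 = 1 - s\<^sup>2" "(norm b2)\<^sup>2 = 1 - s\<^sup>2" and s: "0 < s" "s < 1"
    and pos: "0 \<le> b1 \<bullet> b2" and lt: "b1 \<bullet> b2 < 1"
  shows "(\<integral>\<^sup>+x. \<integral>\<^sup>+y. ennreal (normal_density 0 s (y - x \<bullet> b1) / std_normal_density y *
      (normal_density 0 s (y - x \<bullet> b2) / std_normal_density y)) \<partial>std_gaussian \<partial>gaussian_vec 1)
    = ennreal (1 / (1 - b1 \<bullet> b2))"
proof -
  define r where "r = b1 \<bullet> b2"
  have s2: "0 < s\<^sup>2" "s\<^sup>2 < 1" using s by (simp_all add: power_less_one_iff abs_square_less_1)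
  have np: "(norm (b1 + b2))\<^sup>2 = 2 * (1 - s\<^sup>2) + 2 * r"
    using n by (simp add: power2_norm_eq_inner inner_add inner_commute r_def)
  have nm: "(norm (b1 - b2))\<^sup>2 = 2 * (1 - s\<^sup>2) - 2 * r"
    using n by (simp add: power2_norm_eq_inner inner_diff inner_commute r_def)
  have orth: "(b1 + b2) \<bullet> (b1 - b2) = 0"
    using n by (simp add: power2_norm_eq_inner inner_add inner_diff inner_commute)
  have ne: "b1 + b2 \<noteq> 0"
  proof
    assume "b1 + b2 = 0"
    then have "2 * (1 - s\<^sup>2) + 2 * r = 0" using np by simp
    then show False using pos s2 by (simp add: r_def)
  qed
  have A: "1 - 2 * (1 / (4 * (2 - s\<^sup>2))) * (norm (b1 + b2))\<^sup>2 = (1 - r) / (2 - s\<^sup>2)"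
    unfolding np using s2 by (simp add: field_simps)
  have B: "1 + 2 * (1 / (4 * s\<^sup>2)) * (norm (b1 - b2))\<^sup>2 = (1 - r) / s\<^sup>2"
    unfolding nm using s2 by (simp add: field_simps)
  have "(\<integral>\<^sup>+x. \<integral>\<^sup>+y. ennreal (normal_density 0 s (y - x \<bullet> b1) / std_normal_density y *
      (normal_density 0 s (y - x \<bullet> b2) / std_normal_density y)) \<partial>std_gaussian \<partial>gaussian_vec 1)
    = (\<integral>\<^sup>+x. ennreal (1 / (s * sqrt (2 - s\<^sup>2))) * ennreal
        (exp (1 / (4 * (2 - s\<^sup>2)) * (x \<bullet> (b1 + b2))\<^sup>2 - 1 / (4 * s\<^sup>2) * (x \<bullet> (b1 - b2))\<^sup>2)) \<partial>gaussian_vec 1)"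
    by (intro nn_integral_cong, subst nn_integral_normal_likelihood_product[OF s])
      (use s s2 in \<open>simp add: ennreal_mult'[symmetric] inner_add_right inner_diff_right\<close>)
  also have "\<dots> = ennreal (1 / (s * sqrt (2 - s\<^sup>2))) * (\<integral>\<^sup>+x. ennreal
        (exp (1 / (4 * (2 - s\<^sup>2)) * (x \<bullet> (b1 + b2))\<^sup>2 - 1 / (4 * s\<^sup>2) * (x \<bullet> (b1 - b2))\<^sup>2)) \<partial>gaussian_vec 1)"
    by (rule nn_integral_cmult) measurable
  also have "\<dots> = ennreal (1 / (s * sqrt (2 - s\<^sup>2))) *
      ennreal (1 / sqrt ((1 - r) / (2 - s\<^sup>2) * ((1 - r) / s\<^sup>2)))"
  proof (subst gaussian_vec_exp_orthogonal_squares[OF orth ne])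
    have "0 < (1 - r) / (2 - s\<^sup>2)" using lt s2 by (simp add: r_def)
    then show "2 * (1 / (4 * (2 - s\<^sup>2))) * (norm (b1 + b2))\<^sup>2 < 1" using A by linarith
  qed (use A B in simp_all)
  also have "\<dots> = ennreal (1 / (s * sqrt (2 - s\<^sup>2)) * (1 / sqrt ((1 - r) / (2 - s\<^sup>2) * ((1 - r) / s\<^sup>2))))"
    using s s2 by (simp add: ennreal_mult'[symmetric])
  also have "sqrt ((1 - r) / (2 - s\<^sup>2) * ((1 - r) / s\<^sup>2)) = (1 - r) / (s * sqrt (2 - s\<^sup>2))"
    using s lt by (simp add: real_sqrt_mult real_sqrt_divide r_def)
  finally show ?thesis using s s2 by (simp add: r_def)
qed

section \<open>Likelihood ratios and change of measure\<close>

text \<open>The density of \<open>model_law \<beta> \<sigma>\<close> with respect to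
  \<open>model_law 0 1\<close>. The design has the same law under both, so only the conditional
  densities of the response given the design enter.\<close>

definition likelihood ::
  "real ^ 'p::finite \<Rightarrow> real \<Rightarrow> (real ^ 'n::finite) \<times> (real ^ 'p ^ 'n) \<Rightarrow> real" where
  "likelihood \<beta> \<sigma> z =
     (\<Prod>i\<in>UNIV. normal_density 0 \<sigma> (fst z $ i - snd z $ i \<bullet> \<beta>) / std_normal_density (fst z $ i))"

lemma likelihood_nonneg: "0 \<le> likelihood \<beta> \<sigma> z"
  unfolding likelihood_def by (intro prod_nonneg) simp

lemma likelihood_measurable [measurable]: "likelihood \<beta> \<sigma> \<in> borel_measurable borel"
  unfolding likelihood_def by (simp add: borel_prod[symmetric])

text \<open>Translation invariance of Lebesgue measure moves the shift from \<open>g\<close> to the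
  noise density, which is then divided by the positive standard density.\<close>

lemma nn_integral_gaussian_vec_shift:
  fixes m :: "real ^ 'n::finite"
  assumes "0 < s" and [measurable]: "g \<in> borel_measurable borel"
  shows "(\<integral>\<^sup>+e. g (m + e) \<partial>gaussian_vec s)
    = (\<integral>\<^sup>+y. g y * ennreal (\<Prod>i\<in>UNIV. normal_density 0 s (y $ i - m $ i) / std_normal_density (y $ i))
        \<partial>gaussian_vec 1)"
proof -
  have "(\<integral>\<^sup>+e. g (m + e) \<partial>gaussian_vec s)
    = (\<integral>\<^sup>+e. (\<Prod>i\<in>UNIV. ennreal (normal_density 0 s ((m + e) $ i - m $ i))) * g (m + e) \<partial>lborel)"
    by (subst gaussian_vec_density[OF assms(1)], subst nn_integral_density) auto
  also have "\<dots> = (\<integral>\<^sup>+y. (\<Prod>i\<in>UNIV. ennreal (normal_density 0 s (y $ i - m $ i))) * g y \<partial>distr lborel borel ((+) m))"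
    by (subst nn_integral_distr) auto
  also have "\<dots> = (\<integral>\<^sup>+y. (\<Prod>i\<in>UNIV. ennreal (normal_density 0 s (y $ i - m $ i))) * g y \<partial>lborel)"
    by (simp add: lborel_distr_plus)
  also have "\<dots> = (\<integral>\<^sup>+y. (\<Prod>i\<in>UNIV. ennreal (std_normal_density (y $ i))) *
      (g y * ennreal (\<Prod>i\<in>UNIV. normal_density 0 s (y $ i - m $ i) / std_normal_density (y $ i))) \<partial>lborel)"
  proof (rule nn_integral_cong)
    fix y :: "real ^ 'n"
    have "ennreal (normal_density 0 s (y $ i - m $ i)) = ennreal (std_normal_density (y $ i)) *
        ennreal (normal_density 0 s (y $ i - m $ i) / std_normal_density (y $ i))" for i
      using normal_density_pos[of 1 0 "y $ i"] by (simp add: ennreal_mult'[symmetric])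
    then have "(\<Prod>i\<in>UNIV. ennreal (normal_density 0 s (y $ i - m $ i))) =
      (\<Prod>i\<in>UNIV. ennreal (std_normal_density (y $ i))) *
        ennreal (\<Prod>i\<in>UNIV. normal_density 0 s (y $ i - m $ i) / std_normal_density (y $ i))"
      by (simp add: prod.distrib prod_ennreal)
    then show "(\<Prod>i\<in>UNIV. ennreal (normal_density 0 s (y $ i - m $ i))) * g y =
      (\<Prod>i\<in>UNIV. ennreal (std_normal_density (y $ i))) *
      (g y * ennreal (\<Prod>i\<in>UNIV. normal_density 0 s (y $ i - m $ i) / std_normal_density (y $ i)))"
      by (simp add: ac_simps)
  qed
  also have "\<dots> = (\<integral>\<^sup>+y. g y * ennreal (\<Prod>i\<in>UNIV. normal_density 0 s (y $ i - m $ i) / std_normal_density (y $ i))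
        \<partial>gaussian_vec 1)"
    by (subst gaussian_vec_density, simp, subst nn_integral_density) auto
  finally show ?thesis .
qed

text \<open>The design is integrated last, so that inside, with \<open>X\<close> fixed, the mean
  \<open>X *v \<beta>\<close> is a constant shift.\<close>

lemma nn_integral_model_law_iterated:
  fixes \<beta> :: "real ^ 'p::finite" and G :: "(real ^ 'n::finite) \<times> (real ^ 'p ^ 'n) \<Rightarrow> ennreal"
  assumes "0 < \<sigma>" and [measurable]: "G \<in> borel_measurable borel"
  shows "(\<integral>\<^sup>+z. G z \<partial>model_law \<beta> \<sigma>) = (\<integral>\<^sup>+X. \<integral>\<^sup>+e. G (X *v \<beta> + e, X) \<partial>gaussian_vec \<sigma> \<partial>gaussian_design)"
proof -
  interpret N: prob_space "gaussian_vec \<sigma> :: (real ^ 'n) measure"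
    by (rule prob_space_gaussian_vec[OF assms(1)])
  have s: "sets (gaussian_design \<Otimes>\<^sub>M gaussian_vec \<sigma>)
      = sets (borel :: ((real ^ 'p ^ 'n) \<times> (real ^ 'n)) measure)"
    by (subst borel_prod[symmetric]) (rule sets_pair_measure_cong, auto)
  have "(\<lambda>z::(real ^ 'p ^ 'n) \<times> (real ^ 'n). (fst z *v \<beta> + snd z, fst z)) \<in> borel_measurable borel"
  proof (rule borel_measurable_continuous_onI)
    have "continuous_on UNIV (\<lambda>z::(real ^ 'p ^ 'n) \<times> (real ^ 'n). fst z *v \<beta>)"
      unfolding matrix_vector_mult_def by (intro continuous_intros)
    then show "continuous_on UNIV (\<lambda>z::(real ^ 'p ^ 'n) \<times> (real ^ 'n). (fst z *v \<beta> + snd z, fst z))"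
      by (intro continuous_intros)
  qed
  then have m: "(\<lambda>(X, e). (X *v \<beta> + e, X)) \<in> borel_measurable (gaussian_design \<Otimes>\<^sub>M (gaussian_vec \<sigma> :: (real ^ 'n) measure))"
    by (simp add: case_prod_beta measurable_cong_sets[OF s refl])
  have "(\<lambda>z. G (case z of (X, e) \<Rightarrow> (X *v \<beta> + e, X))) \<in> borel_measurable (gaussian_design \<Otimes>\<^sub>M (gaussian_vec \<sigma> :: (real ^ 'n) measure))"
    by (rule measurable_compose[OF m assms(2)])
  then show ?thesis
    unfolding model_law_def
    by (subst nn_integral_distr[OF m]) (auto simp: N.nn_integral_fst[symmetric])
qed

lemma nn_integral_model_law:
  fixes \<beta> :: "real ^ 'p::finite" and G :: "(real ^ 'n::finite) \<times> (real ^ 'p ^ 'n) \<Rightarrow> ennreal"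
  assumes "0 < \<sigma>" and [measurable]: "G \<in> borel_measurable borel"
  shows "(\<integral>\<^sup>+z. G z \<partial>model_law \<beta> \<sigma>) = (\<integral>\<^sup>+z. G z * ennreal (likelihood \<beta> \<sigma> z) \<partial>model_law 0 1)"
proof -
  have [measurable]: "G \<in> borel_measurable (borel \<Otimes>\<^sub>M borel)" by (simp add: borel_prod)
  have "(\<integral>\<^sup>+e. G (X *v \<beta> + e, X) \<partial>gaussian_vec \<sigma>)
    = (\<integral>\<^sup>+y. G (y, X) * ennreal (likelihood \<beta> \<sigma> (y, X)) \<partial>gaussian_vec 1)" for X
    using nn_integral_gaussian_vec_shift[OF assms(1), of "\<lambda>y. G (y, X)" "X *v \<beta>"]
    by (simp add: likelihood_def matrix_vector_mul_component)
  then show ?thesis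
    by (simp add: nn_integral_model_law_iterated assms)
qed

lemma prob_space_model_law:
  fixes \<beta> :: "real ^ 'p::finite"
  assumes "0 < \<sigma>"
  shows "prob_space (model_law \<beta> \<sigma> :: ((real ^ 'n::finite) \<times> (real ^ 'p ^ 'n)) measure)"
proof
  interpret N: prob_space "gaussian_vec \<sigma> :: (real ^ 'n) measure"
    by (rule prob_space_gaussian_vec[OF assms(1)])
  interpret D: prob_space "gaussian_design :: (real ^ 'p ^ 'n) measure"
    by (rule prob_space_gaussian_design)
  have "(\<integral>\<^sup>+z. 1 \<partial>(model_law \<beta> \<sigma> :: ((real ^ 'n::finite) \<times> (real ^ 'p ^ 'n)) measure)) = 1"
    by (subst nn_integral_model_law_iterated[OF assms]) (simp_all add: N.emeasure_space_1 D.emeasure_space_1)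
  then show "emeasure (model_law \<beta> \<sigma> :: ((real ^ 'n) \<times> (real ^ 'p ^ 'n)) measure) (space (model_law \<beta> \<sigma>)) = 1"
    by simp
qed

lemma sets_model_law [simp, measurable_cong]: "sets (model_law \<beta> \<sigma>) = sets borel"
  by (simp add: model_law_def)

lemma nn_integral_likelihood:
  fixes \<beta> :: "real ^ 'p::finite"
  assumes "0 < \<sigma>"
  shows "(\<integral>\<^sup>+z. ennreal (likelihood \<beta> \<sigma> z)
    \<partial>(model_law 0 1 :: ((real ^ 'n::finite) \<times> (real ^ 'p ^ 'n)) measure)) = 1"
proof -
  interpret prob_space "model_law \<beta> \<sigma> :: ((real ^ 'n::finite) \<times> (real ^ 'p ^ 'n)) measure"
    by (rule prob_space_model_law[OF assms])
  show ?thesis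
    using nn_integral_model_law[OF assms, of "\<lambda>_ :: (real ^ 'n) \<times> (real ^ 'p ^ 'n). 1" \<beta>] by (simp add: emeasure_space_1)
qed

text \<open>Under \<open>model_law 0 1\<close> the pairs of a row and its response are i.i.d., and
  both likelihoods factor over them; hence the \<open>CARD('n')\<close>-th power of the one-row
  value.\<close>

lemma nn_integral_likelihood_product:
  fixes b1 b2 :: "real ^ 'p::finite"
  assumes "(norm b1)\<^sup>2 = 1 - s\<^sup>2" "(norm b2)\<^sup>2 = 1 - s\<^sup>2" "0 < s" "s < 1"
    and "0 \<le> b1 \<bullet> b2" "b1 \<bullet> b2 < 1"
  shows "(\<integral>\<^sup>+z. ennreal (likelihood b1 s z * likelihood b2 s z)
      \<partial>(model_law 0 1 :: ((real ^ 'n::finite) \<times> (real ^ 'p ^ 'n)) measure))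
    = ennreal ((1 / (1 - b1 \<bullet> b2)) ^ CARD('n))"
proof -
  let ?w = "\<lambda>(x :: real ^ 'p) y. ennreal (normal_density 0 s (y - x \<bullet> b1) / std_normal_density y *
      (normal_density 0 s (y - x \<bullet> b2) / std_normal_density y))"
  have sf: "sigma_finite_measure std_gaussian" "sigma_finite_measure (gaussian_vec 1 :: (real ^ 'p) measure)"
    by (simp_all add: prob_space_imp_sigma_finite prob_space_std_gaussian prob_space_gaussian_vec)
  interpret sigma_finite_measure std_gaussian by (rule sf)
  have "(\<integral>\<^sup>+z. ennreal (likelihood b1 s z * likelihood b2 s z)
      \<partial>(model_law 0 1 :: ((real ^ 'n::finite) \<times> (real ^ 'p ^ 'n)) measure))
    = (\<integral>\<^sup>+X. \<integral>\<^sup>+y. (\<Prod>i\<in>UNIV. ?w (X $ i) (y $ i))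
        \<partial>(gaussian_vec 1 :: (real ^ 'n) measure) \<partial>gaussian_design)"
    by (subst nn_integral_model_law_iterated, simp, measurable)
      (auto simp: likelihood_def prod.distrib[symmetric] prod_ennreal[symmetric] simp del: times_divide_eq_left times_divide_eq_right times_divide_times_eq)
  also have "\<dots> = (\<integral>\<^sup>+X. (\<Prod>i\<in>UNIV. \<integral>\<^sup>+y. ?w (X $ i) y \<partial>std_gaussian) \<partial>(gaussian_design :: (real ^ 'p ^ 'n) measure))"
    unfolding gaussian_vec_1[where 'a = 'n]
    by (intro nn_integral_cong nn_integral_iid_vec_prod[OF sf(1)]) auto
  also have "\<dots> = (\<Prod>i\<in>(UNIV :: 'n set). \<integral>\<^sup>+x. \<integral>\<^sup>+y. ?w x y \<partial>std_gaussian \<partial>gaussian_vec 1)"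
    unfolding gaussian_design_def
    by (rule nn_integral_iid_vec_prod[OF sf(2)]) measurable
  also have "\<dots> = ennreal ((1 / (1 - b1 \<bullet> b2)) ^ CARD('n))"
    using assms by (simp only: nn_integral_row_likelihood_product prod_constant) (simp add: ennreal_power)
  finally show ?thesis .
qed

section \<open>Lower bound by a block prior\<close>

text \<open>The target is \<open>0\<close> under \<open>M\<close> and \<open>D\<close> under the law
  with density \<open>L\<close>. In \<open>D\<^sup>2 * L = D * L * h + D * L * (D - h)\<close>, the
  first term is at most \<open>C * h\<^sup>2 + D\<^sup>2 / (4 * C) * L\<^sup>2\<close> and the
  second at most \<open>(h - D)\<^sup>2 * L + D\<^sup>2 / 4 * L\<close>. After integration the terms
  free of \<open>h\<close> total at most \<open>D\<^sup>2 / 2\<close>, which leaves half of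
  \<open>D\<^sup>2\<close>.\<close>

lemma constrained_risk_inequality:
  fixes h L :: "'a \<Rightarrow> real"
  assumes [measurable]: "h \<in> borel_measurable M" "L \<in> borel_measurable M"
    and L: "\<And>z. 0 \<le> L z" "(\<integral>\<^sup>+z. ennreal (L z) \<partial>M) = 1" "(\<integral>\<^sup>+z. ennreal ((L z)\<^sup>2) \<partial>M) \<le> ennreal C"
    and C: "0 < C"
  shows "ennreal (D\<^sup>2 / 2) \<le> ennreal C * (\<integral>\<^sup>+z. ennreal ((h z)\<^sup>2) \<partial>M)
    + (\<integral>\<^sup>+z. ennreal ((h z - D)\<^sup>2) * ennreal (L z) \<partial>M)"
proof -
  have pt: "D\<^sup>2 * l \<le> C * x\<^sup>2 + D\<^sup>2 / (4 * C) * l\<^sup>2 + (x - D)\<^sup>2 * l + D\<^sup>2 / 4 * l"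
    if "0 \<le> l" for x l :: real
  proof -
    have "0 \<le> (2 * C * x - D * l)\<^sup>2 / (4 * C)" using C by simp
    also have "\<dots> = C * x\<^sup>2 + D\<^sup>2 / (4 * C) * l\<^sup>2 - D * l * x"
      using C by (simp add: field_simps power2_eq_square)
    finally have 1: "D * l * x \<le> C * x\<^sup>2 + D\<^sup>2 / (4 * C) * l\<^sup>2" by simp
    have "0 \<le> (x - D + D / 2)\<^sup>2 * l" using that by simp
    also have "\<dots> = (x - D)\<^sup>2 * l + D\<^sup>2 / 4 * l - D * l * (D - x)"
      by (simp add: power2_eq_square algebra_simps)
    finally show ?thesis using 1 by (simp add: power2_eq_square algebra_simps)
  qed
  let ?R0 = "\<integral>\<^sup>+z. ennreal ((h z)\<^sup>2) \<partial>M" and ?R1 = "\<integral>\<^sup>+z. ennreal ((h z - D)\<^sup>2) * ennreal (L z) \<partial>M"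
  have "ennreal (D\<^sup>2) = (\<integral>\<^sup>+z. ennreal (D\<^sup>2) * ennreal (L z) \<partial>M)"
    by (simp add: nn_integral_cmult L)
  also have "\<dots> \<le> (\<integral>\<^sup>+z. ennreal C * ennreal ((h z)\<^sup>2) + ennreal (D\<^sup>2 / (4 * C)) * ennreal ((L z)\<^sup>2)
      + ennreal ((h z - D)\<^sup>2) * ennreal (L z) + ennreal (D\<^sup>2 / 4) * ennreal (L z) \<partial>M)"
    using pt[OF L(1)] C L(1)
    by (intro nn_integral_mono) (simp add: ennreal_mult'[symmetric] ennreal_plus[symmetric] del: ennreal_plus)
  also have "\<dots> = ennreal C * ?R0 + ennreal (D\<^sup>2 / (4 * C)) * (\<integral>\<^sup>+z. ennreal ((L z)\<^sup>2) \<partial>M) + ?R1 + ennreal (D\<^sup>2 / 4)"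
    by (simp add: nn_integral_add nn_integral_cmult L(2))
  also have "\<dots> \<le> ennreal C * ?R0 + ennreal (D\<^sup>2 / (4 * C)) * ennreal C + ?R1 + ennreal (D\<^sup>2 / 4)"
    using L(3) by (intro add_mono mult_left_mono) auto
  also have "ennreal (D\<^sup>2 / (4 * C)) * ennreal C = ennreal (D\<^sup>2 / 4)"
    using C by (simp add: ennreal_mult'[symmetric])
  also have "ennreal C * ?R0 + ennreal (D\<^sup>2 / 4) + ?R1 + ennreal (D\<^sup>2 / 4)
    = (ennreal (D\<^sup>2 / 4) + ennreal (D\<^sup>2 / 4)) + (ennreal C * ?R0 + ?R1)" by (simp add: ac_simps)
  also have "ennreal (D\<^sup>2 / 4) + ennreal (D\<^sup>2 / 4) = ennreal (D\<^sup>2 / 2)"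
    by (simp add: ennreal_plus[symmetric] del: ennreal_plus)
  finally have "ennreal (D\<^sup>2) \<le> ennreal (D\<^sup>2 / 2) + (ennreal C * ?R0 + ?R1)" .
  moreover have "ennreal (D\<^sup>2) = ennreal (D\<^sup>2 / 2) + ennreal (D\<^sup>2 / 2)"
    by (simp add: ennreal_plus[symmetric] del: ennreal_plus)
  \<comment> \<open>Only the finite quantity \<open>D\<^sup>2 / 2\<close> is cancelled, so infinite
    risks are allowed.\<close>
  ultimately show ?thesis by (simp add: ennreal_add_left_cancel_le)
qed

section \<open>The block prior and its chi-square bound\<close>

text \<open>The generating function of the number of agreements with \<open>g\<close>, before
  division by \<open>m ^ K\<close>: the sum factors over the blocks, and in each one choice gives
  \<open>T\<close> while the other \<open>m - 1\<close> give \<open>1\<close>.\<close>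

lemma sum_PiE_agreements:
  fixes T :: "'a::comm_semiring_1"
  assumes "\<And>i. i < K \<Longrightarrow> g i < m"
  shows "(\<Sum>f\<in>PiE {..<K} (\<lambda>_. {..<m}). \<Prod>i<K. if f i = g i then T else 1) = (of_nat (m - 1) + T) ^ K"
proof -
  have "(\<Sum>f\<in>PiE {..<K} (\<lambda>_. {..<m}). \<Prod>i<K. if f i = g i then T else 1)
    = (\<Prod>i<K. \<Sum>j<m. if j = g i then T else 1)"
    by (rule prod_sum_PiE[symmetric]) auto
  also have "\<dots> = (\<Prod>i<K. of_nat (m - 1) + T)"
  proof (rule prod.cong[OF refl])
    fix i assume "i \<in> {..<K}"
    then have gi: "g i \<in> {..<m}" using assms by simp
    have "(\<Sum>j<m. if j = g i then T else 1) = T + (\<Sum>j\<in>{..<m} - {g i}. if j = g i then T else 1)"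
      by (subst sum.remove[OF _ gi]) auto
    also have "(\<Sum>j\<in>{..<m} - {g i}. if j = g i then T else 1) = (\<Sum>j\<in>{..<m} - {g i}. 1)"
      by (rule sum.cong) auto
    also have "\<dots> = of_nat (m - 1)"
      using gi by (simp add: card_Diff_singleton)
    finally show "(\<Sum>j<m. if j = g i then T else 1) = of_nat (m - 1) + T" by (simp add: add.commute)
  qed
  finally show ?thesis by simp
qed

text \<open>\<open>c i j\<close> stands for the \<open>j\<close>-th coordinate of block
  \<open>i\<close>, and \<open>f\<close> selects a position in each block. With positions as
  numbers, the uniform prior lives on the product set
  \<open>PiE {..<K} (\<lambda>_. {..<m})\<close>.\<close>

definition block_vec :: "real \<Rightarrow> (nat \<Rightarrow> nat \<Rightarrow> 'p) \<Rightarrow> nat \<Rightarrow> (nat \<Rightarrow> nat) \<Rightarrow> real ^ 'p::finite" where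
  "block_vec b c K f = (\<Sum>i<K. b *\<^sub>R axis (c i (f i)) 1)"

lemma block_vec_in_B0: "block_vec b c K f \<in> B0 K"
proof -
  have "{l. block_vec b c K f $ l \<noteq> 0} \<subseteq> (\<lambda>i. c i (f i)) ` {..<K}"
  proof (rule subsetI, rule ccontr)
    fix l assume l: "l \<in> {l. block_vec b c K f $ l \<noteq> 0}" "l \<notin> (\<lambda>i. c i (f i)) ` {..<K}"
    have "block_vec b c K f $ l = (\<Sum>i<K. b * axis (c i (f i)) 1 $ l)"
      by (simp add: block_vec_def)
    also have "\<dots> = 0" using l(2) by (intro sum.neutral) (auto simp: axis_def)
    finally show False using l(1) by simp
  qed
  then have "card {l. block_vec b c K f $ l \<noteq> 0} \<le> card ((\<lambda>i. c i (f i)) ` {..<K})"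
    by (intro card_mono) auto
  also have "\<dots> \<le> K" using card_image_le[of "{..<K}" "\<lambda>i. c i (f i)"] by simp
  finally show ?thesis by (simp add: B0_def)
qed

text \<open>Different blocks share no coordinate, so only equal choices in the same block
  contribute. The case \<open>f = g\<close> gives the common squared norm
  \<open>b\<^sup>2 * K\<close>.\<close>

lemma inner_block_vec:
  assumes c: "inj_on (\<lambda>(i, j). c i j) ({..<K} \<times> {..<m})"
    and f: "f \<in> PiE {..<K} (\<lambda>_. {..<m})" and g: "g \<in> PiE {..<K} (\<lambda>_. {..<m})"
  shows "block_vec b c K f \<bullet> block_vec b c K g = b\<^sup>2 * (\<Sum>i<K. if f i = g i then 1 else 0)"
proof -
  have eq: "c i (f i) = c j (g j) \<longleftrightarrow> i = j \<and> f i = g i" if "i < K" "j < K" for i j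
  proof -
    have "(i, f i) \<in> {..<K} \<times> {..<m}" "(j, g j) \<in> {..<K} \<times> {..<m}"
      using that f g by (auto dest: PiE_mem)
    from inj_on_eq_iff[OF c this] show ?thesis by auto
  qed
  have "block_vec b c K f \<bullet> block_vec b c K g
    = (\<Sum>i<K. \<Sum>j<K. b\<^sup>2 * (if c i (f i) = c j (g j) then 1 else 0))"
    unfolding block_vec_def inner_sum_left
    by (simp add: inner_sum_right inner_axis_axis power2_eq_square if_distrib cong: if_cong)
  also have "\<dots> = (\<Sum>i<K. \<Sum>j<K. if i = j then b\<^sup>2 * (if f i = g i then 1 else 0) else 0)"
    by (intro sum.cong refl) (auto simp: eq)
  also have "\<dots> = (\<Sum>i<K. b\<^sup>2 * (if f i = g i then 1 else 0))" by simp
  finally show ?thesis by (simp add: sum_distrib_left)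
qed

text \<open>Blocks are consecutive runs of length \<open>m\<close> in an enumeration of
  \<open>'p\<close>; division of \<open>i * m + j\<close> by \<open>m\<close> recovers block and
  position.\<close>

lemma ex_block_injection:
  assumes "K * m \<le> CARD('p::finite)"
  shows "\<exists>c :: nat \<Rightarrow> nat \<Rightarrow> 'p. inj_on (\<lambda>(i, j). c i j) ({..<K} \<times> {..<m})"
proof -
  obtain h where h: "bij_betw h {0..<CARD('p)} (UNIV :: 'p set)"
    using ex_bij_betw_nat_finite[of "UNIV :: 'p set"] by auto
  have lt: "i * m + j < CARD('p)" if "i < K" "j < m" for i j
  proof -
    have "i * m + j < Suc i * m" using that by simp
    also have "\<dots> \<le> K * m" using that by (intro mult_le_mono) auto
    finally show ?thesis using assms by simp
  qed
  have "inj_on (\<lambda>(i, j). h (i * m + j)) ({..<K} \<times> {..<m})"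
  proof (rule inj_onI, clarsimp)
    fix i j i' j'
    assume a: "h (i * m + j) = h (i' * m + j')" "i < K" "j < m" "i' < K" "j' < m"
    then have "i * m + j = i' * m + j'"
      using bij_betw_imp_inj_on[OF h] lt by (auto dest: inj_onD)
    then have "(i * m + j) div m = (i' * m + j') div m" "(i * m + j) mod m = (i' * m + j') mod m" by simp_all
    then show "i = i' \<and> j = j'" using a by simp
  qed
  then show ?thesis by blast
qed

text \<open>Used to replace the likelihood moments by exponentials, which are multiplicative over
  the blocks.\<close>

lemma inverse_one_minus_le_exp:
  fixes x :: real
  assumes "0 \<le> x" "x \<le> 1 / 2"
  shows "1 / (1 - x) \<le> exp (2 * x)"
proof -
  have "x * (1 - 2 * x) \<ge> 0" using assms by simp
  then have "1 \<le> (1 + 2 * x) * (1 - x)" by (simp add: algebra_simps)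
  then have "1 / (1 - x) \<le> 1 + 2 * x" using assms by (simp add: field_simps)
  also have "\<dots> \<le> exp (2 * x)" by (rule exp_ge_add_one_self)
  finally show ?thesis .
qed

text \<open>Expanding the square gives an average over pairs \<open>(f, g)\<close> of likelihood
  moments, each bounded by a factor \<open>T = exp (2 * n * b\<^sup>2)\<close> per agreeing block,
  where \<open>n = CARD('n)\<close>. Averaging yields \<open>(1 + (T - 1) / m) ^ K\<close>. The
  assumption \<open>half\<close> keeps all inner products in the range of the exponential
  bound.\<close>

lemma mixture_second_moment:
  fixes c :: "nat \<Rightarrow> nat \<Rightarrow> 'p::finite"
  assumes c: "inj_on (\<lambda>(i, j). c i j) ({..<K} \<times> {..<m})" and m: "0 < m"
    and s: "0 < s" "s < 1" "b\<^sup>2 * real K = 1 - s\<^sup>2" and half: "b\<^sup>2 * real K \<le> 1 / 2"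
  defines "P \<equiv> PiE {..<K} (\<lambda>_. {..<m})"
  shows "(\<integral>\<^sup>+z. ennreal (((\<Sum>f\<in>P. likelihood (block_vec b c K f) s z) / real (card P))\<^sup>2)
      \<partial>(model_law 0 1 :: ((real ^ 'n::finite) \<times> (real ^ 'p ^ 'n)) measure))
    \<le> ennreal (exp (real K * (exp (2 * real CARD('n) * b\<^sup>2) - 1) / real m))"
proof -
  let ?M = "model_law 0 1 :: ((real ^ 'n::finite) \<times> (real ^ 'p ^ 'n)) measure"
  let ?\<beta> = "block_vec b c K" and ?N = "real (card P)"
  define T where "T = exp (2 * real CARD('n) * b\<^sup>2)"
  have T: "1 \<le> T" by (simp add: T_def)
  have fin: "finite P" unfolding P_def by (intro finite_PiE) auto
  have N: "?N = real m ^ K" by (simp add: P_def card_PiE)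
  have N0: "0 < ?N" using m by (simp add: N)
  have ip: "?\<beta> f \<bullet> ?\<beta> g = b\<^sup>2 * (\<Sum>i<K. if f i = g i then 1 else 0)" if "f \<in> P" "g \<in> P" for f g
    using inner_block_vec[OF c] that by (simp add: P_def)
  have norm: "(norm (?\<beta> f))\<^sup>2 = 1 - s\<^sup>2" if "f \<in> P" for f
    using ip[OF that that] s by (simp add: power2_norm_eq_inner)
  have ip_bounds: "0 \<le> ?\<beta> f \<bullet> ?\<beta> g" "?\<beta> f \<bullet> ?\<beta> g \<le> 1 / 2" if "f \<in> P" "g \<in> P" for f g
  proof -
    show "0 \<le> ?\<beta> f \<bullet> ?\<beta> g" unfolding ip[OF that] by (intro mult_nonneg_nonneg sum_nonneg) auto
    have "(\<Sum>i<K. if f i = g i then 1 else 0 :: real) \<le> (\<Sum>i<K. 1)" by (rule sum_mono) auto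
    then have "?\<beta> f \<bullet> ?\<beta> g \<le> b\<^sup>2 * real K" unfolding ip[OF that] by (intro mult_left_mono) auto
    then show "?\<beta> f \<bullet> ?\<beta> g \<le> 1 / 2" using half by simp
  qed
  let ?E = "\<lambda>f g. (1 / (1 - ?\<beta> f \<bullet> ?\<beta> g)) ^ CARD('n)"
  have term_le: "?E f g \<le> (\<Prod>i<K. if f i = g i then T else 1)" if "f \<in> P" "g \<in> P" for f g
  proof -
    have "?E f g \<le> exp (2 * (?\<beta> f \<bullet> ?\<beta> g)) ^ CARD('n)"
      using ip_bounds[OF that] by (intro power_mono inverse_one_minus_le_exp) auto
    also have "\<dots> = exp (\<Sum>i<K. 2 * real CARD('n) * b\<^sup>2 * (if f i = g i then 1 else 0))"
      unfolding exp_of_nat_mult[symmetric] ip[OF that] by (simp add: sum_distrib_left mult.assoc mult.left_commute)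
    also have "\<dots> = (\<Prod>i<K. if f i = g i then T else 1)"
      unfolding exp_sum[OF finite_lessThan] by (intro prod.cong) (auto simp: T_def)
    finally show ?thesis .
  qed
  have "(\<integral>\<^sup>+z. ennreal (((\<Sum>f\<in>P. likelihood (?\<beta> f) s z) / ?N)\<^sup>2) \<partial>?M)
    = (\<integral>\<^sup>+z. (\<Sum>g\<in>P. \<Sum>f\<in>P. ennreal (1 / ?N\<^sup>2) * ennreal (likelihood (?\<beta> f) s z * likelihood (?\<beta> g) s z)) \<partial>?M)"
  proof (rule nn_integral_cong)
    fix z :: "(real ^ 'n) \<times> (real ^ 'p ^ 'n)"
    have "((\<Sum>f\<in>P. likelihood (?\<beta> f) s z) / ?N)\<^sup>2
      = (\<Sum>g\<in>P. \<Sum>f\<in>P. 1 / ?N\<^sup>2 * (likelihood (?\<beta> f) s z * likelihood (?\<beta> g) s z))"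
      by (simp add: power_divide power2_eq_square sum_product sum_divide_distrib mult.commute)
    also have "ennreal \<dots> = (\<Sum>g\<in>P. \<Sum>f\<in>P. ennreal (1 / ?N\<^sup>2 * (likelihood (?\<beta> f) s z * likelihood (?\<beta> g) s z)))"
      by (subst sum_ennreal[symmetric] | simp add: likelihood_nonneg sum_nonneg del: times_divide_eq_left)+
    also have "\<dots> = (\<Sum>g\<in>P. \<Sum>f\<in>P. ennreal (1 / ?N\<^sup>2) * ennreal (likelihood (?\<beta> f) s z * likelihood (?\<beta> g) s z))"
      by (intro sum.cong refl ennreal_mult') simp
    finally show "ennreal (((\<Sum>f\<in>P. likelihood (?\<beta> f) s z) / ?N)\<^sup>2)
      = (\<Sum>g\<in>P. \<Sum>f\<in>P. ennreal (1 / ?N\<^sup>2) * ennreal (likelihood (?\<beta> f) s z * likelihood (?\<beta> g) s z))" .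
  qed
  also have "\<dots> = (\<Sum>g\<in>P. \<Sum>f\<in>P. ennreal (1 / ?N\<^sup>2) * (\<integral>\<^sup>+z. ennreal (likelihood (?\<beta> f) s z * likelihood (?\<beta> g) s z) \<partial>?M))"
    by (simp add: nn_integral_sum nn_integral_cmult)
  also have "\<dots> = (\<Sum>g\<in>P. \<Sum>f\<in>P. ennreal (1 / ?N\<^sup>2) * ennreal (?E f g))"
  proof (intro sum.cong refl arg_cong2[where f = "(*)"])
    fix f g assume fg: "g \<in> P" "f \<in> P"
    show "(\<integral>\<^sup>+z. ennreal (likelihood (?\<beta> f) s z * likelihood (?\<beta> g) s z) \<partial>?M) = ennreal (?E f g)"
      using ip_bounds[OF fg(2,1)] s by (intro nn_integral_likelihood_product norm fg) auto
  qed
  also have "\<dots> \<le> (\<Sum>g\<in>P. \<Sum>f\<in>P. ennreal (1 / ?N\<^sup>2 * (\<Prod>i<K. if f i = g i then T else 1)))"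
  proof (intro sum_mono)
    fix f g assume fg: "g \<in> P" "f \<in> P"
    show "ennreal (1 / ?N\<^sup>2) * ennreal (?E f g) \<le> ennreal (1 / ?N\<^sup>2 * (\<Prod>i<K. if f i = g i then T else 1))"
      by (subst ennreal_mult'[symmetric]) (auto simp del: times_divide_eq_left intro!: ennreal_leI mult_left_mono term_le fg)
  qed
  also have "\<dots> = ennreal (\<Sum>g\<in>P. \<Sum>f\<in>P. 1 / ?N\<^sup>2 * (\<Prod>i<K. if f i = g i then T else 1))"
  proof -
    have "0 \<le> 1 / ?N\<^sup>2 * (\<Prod>i<K. if f i = g i then T else 1)" for f g :: "nat \<Rightarrow> nat"
      using T by (intro mult_nonneg_nonneg prod_nonneg) auto
    then show ?thesis
      by (intro trans[OF sum.cong[OF refl sum_ennreal] sum_ennreal] sum_nonneg)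
  qed
  \<comment> \<open>The inner sum over \<open>f\<close> is the same for every \<open>g\<close>, so
    the outer sum only cancels one of the two factors \<open>?N = m ^ K\<close>.\<close>
  also have "(\<Sum>g\<in>P. \<Sum>f\<in>P. 1 / ?N\<^sup>2 * (\<Prod>i<K. if f i = g i then T else 1))
    = (\<Sum>g\<in>P. 1 / ?N\<^sup>2 * (real (m - 1) + T) ^ K)"
  proof (rule sum.cong[OF refl])
    fix g assume "g \<in> P"
    then have "\<And>i. i < K \<Longrightarrow> g i < m" by (auto simp: P_def dest: PiE_mem)
    from sum_PiE_agreements[where K = K and g = g and T = T, OF this] show "(\<Sum>f\<in>P. 1 / ?N\<^sup>2 * (\<Prod>i<K. if f i = g i then T else 1))
        = 1 / ?N\<^sup>2 * (real (m - 1) + T) ^ K"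
      by (simp add: P_def sum_distrib_left[symmetric] sum_divide_distrib[symmetric])
  qed
  also have "\<dots> = ((real (m - 1) + T) / real m) ^ K"
    using N0 by (simp add: power2_eq_square N power_divide)
  also have "(real (m - 1) + T) / real m = 1 + (T - 1) / real m"
    using m by (simp add: field_simps of_nat_diff)
  also have "(1 + (T - 1) / real m) ^ K \<le> exp ((T - 1) / real m) ^ K"
    using T by (intro power_mono exp_ge_add_one_self add_nonneg_nonneg) auto
  also have "\<dots> = exp (real K * (T - 1) / real m)"
    by (simp add: exp_of_nat_mult[symmetric])
  finally show ?thesis by (simp add: T_def ennreal_leI)
qed

section \<open>From the block prior to a trade-off between the two maximal risks\<close>

text \<open>The constrained risk inequality with \<open>L\<close> the average of the likelihoods
  over the prior: \<open>eta\<close> is \<open>0\<close> under the null and \<open>\<Delta>\<close>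
  at every point of the prior, and the risk averaged over the prior is at most the maximal
  one.\<close>

lemma max_risk_tradeoff:
  fixes h :: "(real ^ 'n::finite) \<times> (real ^ 'p::finite ^ 'n) \<Rightarrow> real"
  assumes h: "h \<in> borel_measurable borel"
    and K: "0 < K" "K \<le> k" "K * m \<le> CARD('p)" and m: "0 < m"
    and \<Delta>: "0 < \<Delta>" "\<Delta> \<le> 1 / 2"
  shows "ennreal (\<Delta>\<^sup>2 / 2)
    \<le> ennreal (exp (real K * (exp (2 * real CARD('n) * \<Delta> / real K) - 1) / real m)) * max_risk h 1 + max_risk h k"
proof -
  let ?M = "model_law 0 1 :: ((real ^ 'n::finite) \<times> (real ^ 'p ^ 'n)) measure"
  obtain c :: "nat \<Rightarrow> nat \<Rightarrow> 'p" where c: "inj_on (\<lambda>(i, j). c i j) ({..<K} \<times> {..<m})"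
    using ex_block_injection[OF K(3)] by blast
  \<comment> \<open>These values give \<open>b\<^sup>2 * K = \<Delta>\<close> and
    \<open>s\<^sup>2 + b\<^sup>2 * K = 1\<close>: the response keeps unit variance and
    \<open>eta\<close> equals \<open>\<Delta>\<close>.\<close>
  define b where "b = sqrt (\<Delta> / real K)"
  define s where "s = sqrt (1 - \<Delta>)"
  have b2: "b\<^sup>2 = \<Delta> / real K" using \<Delta> by (simp add: b_def)
  have s: "0 < s" "s < 1" "s\<^sup>2 = 1 - \<Delta>" using \<Delta> by (simp_all add: s_def)
  have bK: "b\<^sup>2 * real K = \<Delta>" using K by (simp add: b2)
  define P where "P = PiE {..<K} (\<lambda>_. {..<m})"
  define N where "N = real (card P)"
  let ?\<beta> = "block_vec b c K"
  define L where "L = (\<lambda>z :: (real ^ 'n) \<times> (real ^ 'p ^ 'n). (\<Sum>f\<in>P. likelihood (?\<beta> f) s z) / N)"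
  have fin: "finite P" unfolding P_def by (intro finite_PiE) auto
  have N0: "0 < N" using m by (simp add: N_def P_def card_PiE)
  have inv_sum: "ennreal (1 / N) * (\<Sum>f\<in>P. ennreal 1) = 1"
    using N0 by (simp add: N_def ennreal_of_nat_eq_real_of_nat ennreal_mult'[symmetric])
  have Lm [measurable]: "L \<in> borel_measurable borel" unfolding L_def by measurable
  have L0: "0 \<le> L z" for z unfolding L_def using N0 by (intro divide_nonneg_pos sum_nonneg likelihood_nonneg)
  have Le: "ennreal (L z) = ennreal (1 / N) * (\<Sum>f\<in>P. ennreal (likelihood (?\<beta> f) s z))" for z
    using N0 by (simp add: L_def sum_ennreal likelihood_nonneg ennreal_mult'[symmetric])
  have GL: "(\<integral>\<^sup>+z. G z * ennreal (L z) \<partial>?M)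
      = ennreal (1 / N) * (\<Sum>f\<in>P. \<integral>\<^sup>+z. G z * ennreal (likelihood (?\<beta> f) s z) \<partial>?M)"
    if [measurable]: "G \<in> borel_measurable borel" for G
  proof -
    have "(\<integral>\<^sup>+z. G z * ennreal (L z) \<partial>?M)
      = (\<integral>\<^sup>+z. ennreal (1 / N) * (\<Sum>f\<in>P. G z * ennreal (likelihood (?\<beta> f) s z)) \<partial>?M)"
      by (simp add: Le sum_distrib_left mult.left_commute)
    then show ?thesis by (simp add: nn_integral_cmult nn_integral_sum)
  qed
  have L1: "(\<integral>\<^sup>+z. ennreal (L z) \<partial>?M) = 1"
    using GL[of "\<lambda>_. 1"] inv_sum by (simp add: nn_integral_likelihood[OF s(1)])
  have norm: "(norm (?\<beta> f))\<^sup>2 = \<Delta>" if "f \<in> P" for f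
    using inner_block_vec[OF c, of f f b] that bK by (simp add: P_def power2_norm_eq_inner)
  \<comment> \<open>The null point \<open>(0, 1)\<close> is admissible in \<open>B0 1\<close>, and
    its \<open>eta\<close> is \<open>0\<close>.\<close>
  have R0: "(\<integral>\<^sup>+z. ennreal ((h z)\<^sup>2) \<partial>?M) \<le> max_risk h 1"
    unfolding max_risk_def
    by (rule SUP_upper2[of "(0, 1)"]) (auto simp: B0_def eta_def)
  have "(\<integral>\<^sup>+z. ennreal ((h z - \<Delta>)\<^sup>2) * ennreal (likelihood (?\<beta> f) s z) \<partial>?M) \<le> max_risk h k"
    if "f \<in> P" for f
  proof -
    have "eta (?\<beta> f) s = \<Delta>" using norm[OF that] s by (simp add: eta_def)
    moreover have "?\<beta> f \<in> B0 k"
      using block_vec_in_B0[of b c K f] K(2) by (simp add: B0_def)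
    ultimately have "(\<integral>\<^sup>+z. ennreal ((h z - \<Delta>)\<^sup>2) \<partial>model_law (?\<beta> f) s) \<le> max_risk h k"
      unfolding max_risk_def using s by (intro SUP_upper2[of "(?\<beta> f, s)"]) auto
    then show ?thesis
      using h by (subst (asm) nn_integral_model_law[OF s(1)]) auto
  qed
  then have "(\<Sum>f\<in>P. \<integral>\<^sup>+z. ennreal ((h z - \<Delta>)\<^sup>2) * ennreal (likelihood (?\<beta> f) s z) \<partial>?M)
      \<le> (\<Sum>f\<in>P. ennreal 1) * max_risk h k"
    by (simp add: sum_bounded_above)
  then have "(\<integral>\<^sup>+z. ennreal ((h z - \<Delta>)\<^sup>2) * ennreal (L z) \<partial>?M)
      \<le> ennreal (1 / N) * ((\<Sum>f\<in>P. ennreal 1) * max_risk h k)"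
    using h by (subst GL) (auto intro!: mult_left_mono)
  then have R1: "(\<integral>\<^sup>+z. ennreal ((h z - \<Delta>)\<^sup>2) * ennreal (L z) \<partial>?M) \<le> max_risk h k"
    by (simp only: mult.assoc[symmetric] inv_sum mult_1)
  define C where "C = exp (real K * (exp (2 * real CARD('n) * \<Delta> / real K) - 1) / real m)"
  have "(\<integral>\<^sup>+z. ennreal ((L z)\<^sup>2) \<partial>?M) \<le> ennreal C"
    using mixture_second_moment[OF c m s(1,2), of b, where 'n = 'n] s(3) bK \<Delta>
    by (simp add: L_def N_def P_def C_def b2)
  from constrained_risk_inequality[OF _ _ L0 L1 this, of h \<Delta>] h
  have "ennreal (\<Delta>\<^sup>2 / 2) \<le> ennreal C * (\<integral>\<^sup>+z. ennreal ((h z)\<^sup>2) \<partial>?M)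
      + (\<integral>\<^sup>+z. ennreal ((h z - \<Delta>)\<^sup>2) * ennreal (L z) \<partial>?M)"
    by (simp add: C_def)
  also have "\<dots> \<le> ennreal C * max_risk h 1 + max_risk h k"
    using R0 R1 by (intro add_mono mult_left_mono) auto
  finally show ?thesis by (simp add: C_def)
qed

section \<open>Calibration of block number, block size and signal strength\<close>

text \<open>Each of the two roundings costs at most a factor 2, so
  \<open>K / m \<le> 2 * ln p\<close> for \<open>m = p div K\<close>, and the inner exponent
  \<open>t = a / 10 * (S / K)\<close> is at most \<open>a / 5\<close>. Then
  \<open>exp t - 1 \<le> 11 / 50 * a\<close>, and \<open>22 / 50 < 1 / 2\<close>; the constant
  \<open>1 / 20\<close> in the signal strength is chosen for this.\<close>

lemma block_exponent_bound:
  fixes p n :: nat and a :: real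
  assumes p: "2 \<le> p" and n: "0 < n" and a: "0 < a" "a < 1 / 2" and "sqrt (real p * ln (real p)) \<le> real p"
  defines "S \<equiv> sqrt (real p * ln (real p))"
  defines "K \<equiv> nat \<lfloor>S\<rfloor>"
  shows "0 < K" "real K \<le> S" "0 < p div K" "K * (p div K) \<le> p"
    "real K * (exp (2 * real n * (a / 20 * S / real n) / real K) - 1) / real (p div K) \<le> a / 2 * ln (real p)"
proof -
  have l2: "1 / 2 \<le> ln (2::real)" using ln_2_less_1 ln2_ge_two_thirds by linarith
  have "ln 2 \<le> ln (real p)" using p by simp
  with l2 have lp: "1 / 2 \<le> ln (real p)" by linarith
  have "1 \<le> real p * ln (real p)"
    using mult_mono[of 2 "real p" "1 / 2" "ln (real p)"] lp p by simp
  then have S1: "1 \<le> S" by (simp add: S_def)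
  have S2: "S\<^sup>2 = real p * ln (real p)" using lp by (simp add: S_def)
  show K0: "0 < K" using S1 by (simp add: K_def)
  have Kf: "real K = of_int \<lfloor>S\<rfloor>" using S1 by (simp add: K_def)
  show KS: "real K \<le> S" using Kf by linarith
  \<comment> \<open>\<open>S < K + 1 \<le> 2 * K\<close>, as \<open>K\<close> is positive.\<close>
  have SK: "S \<le> 2 * real K" using Kf S1 K0 by linarith
  have Kp: "K \<le> p" using KS assms(5) by (simp add: S_def)
  define m where "m = p div K"
  show m0: "0 < p div K" using Kp K0 by (simp add: div_greater_zero_iff)
  show "K * (p div K) \<le> p" by simp
  \<comment> \<open>Division with remainder; as \<open>m\<close> is positive,
    \<open>m + 1 \<le> 2 * m\<close>.\<close>
  have "p < K * (m + 1)"
    using K0 unfolding m_def by (metis Suc_eq_plus1 dividend_less_times_div mult_Suc_right add.commute)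
  also have "\<dots> \<le> 2 * (K * m)" using m0 by (simp add: m_def algebra_simps)
  finally have "real p \<le> 2 * (real K * real m)" by (metis of_nat_mult of_nat_numeral of_nat_le_iff less_imp_le)
  then have pm: "real p * real K \<le> 2 * (real K)\<^sup>2 * real m"
    using K0 by (simp add: power2_eq_square)
  have "(real K)\<^sup>2 \<le> real p * ln (real p)" using KS S2 by (metis of_nat_0_le_iff power_mono)
  then have "2 * (real K)\<^sup>2 * real m \<le> 2 * (real p * ln (real p)) * real m"
    by (intro mult_right_mono) auto
  with pm have "real p * real K \<le> real p * (2 * ln (real p) * real m)" by simp
  then have Km: "real K / real m \<le> 2 * ln (real p)"
    using p m0 by (simp add: m_def divide_le_eq)
  define t where "t = 2 * real n * (a / 20 * S / real n) / real K"
  have t_eq: "t = a / 10 * (S / real K)" using n by (simp add: t_def)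
  have "S / real K \<le> 2" using SK K0 by (simp add: divide_le_eq)
  then have t: "t \<le> a / 5" unfolding t_eq using a mult_left_mono[of "S / real K" 2 "a / 10"] by simp
  have t0: "0 \<le> t" unfolding t_eq using a S1 by simp
  have "exp t \<le> 1 + t + t\<^sup>2" using t t0 a by (intro exp_bound) auto
  also have "t\<^sup>2 \<le> t * (1 / 10)" unfolding power2_eq_square using t t0 a by (intro mult_left_mono) auto
  finally have "exp t - 1 \<le> 11 / 50 * a" using t by simp
  moreover have "0 \<le> exp t - 1" using t0 by simp
  ultimately have "real K / real m * (exp t - 1) \<le> 2 * ln (real p) * (11 / 50 * a)"
    using Km lp by (intro mult_mono) auto
  also have "\<dots> = 22 / 50 * (a * ln (real p))" by simp
  also have "\<dots> \<le> a / 2 * ln (real p)" using a lp by simp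
  finally show "real K * (exp (2 * real n * (a / 20 * S / real n) / real K) - 1) / real (p div K) \<le> a / 2 * ln (real p)"
    by (simp add: t_def m_def)
qed

theorem proposition3p1:
  fixes etahat :: "(real ^ 'n::finite) \<times> (real ^ 'p::finite ^ 'n) \<Rightarrow> real"
    and n p k :: nat and a :: real
  assumes "n = CARD('n)" and "p = CARD('p)"
    and "real p * ln (real p) \<le> (real n)\<^sup>2"
    and "0 < a" and "a < 1 / 2"
    and "real p powr (1 - a) * (ln (real p))\<^sup>2 \<ge> 16 * real n"
    and "etahat \<in> borel_measurable borel"
    and "sqrt (real p * ln (real p)) \<le> real k" and "k \<le> p"
  shows "max_risk etahat 1 / ennreal (1 / real n * sqrt (real p / real n))
       + max_risk etahat k / ennreal (real p * ln (real p) / (real n)\<^sup>2)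
       \<ge> ennreal (a\<^sup>2 / 4 ^ 5)"
proof -
  have n0: "0 < n" and "0 < p" using assms(1,2) by simp_all
  \<comment> \<open>At \<open>p = 1\<close> the logarithm vanishes, contradicting the lower bound
    \<open>16 * n\<close> on its multiple.\<close>
  have "p \<noteq> 1"
  proof
    assume "p = 1"
    then show False using assms(6) n0 by simp
  qed
  then have p2: "2 \<le> p" using \<open>0 < p\<close> by simp
  then have lp: "0 < ln (real p)" by simp
  define S where "S = sqrt (real p * ln (real p))"
  have S2: "S\<^sup>2 = real p * ln (real p)" and S0: "0 < S" using lp p2 by (simp_all add: S_def)
  have Sn: "S \<le> real n" unfolding S_def using assms(3) by (intro real_le_lsqrt) auto
  have Sp: "sqrt (real p * ln (real p)) \<le> real p" using assms(8,9) by linarith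
  define K where "K = nat \<lfloor>S\<rfloor>"
  note blk = block_exponent_bound[OF p2 n0 assms(4,5) Sp, folded S_def, folded K_def]
  define \<Delta> where "\<Delta> = a / 20 * S / real n"
  have \<Delta>0: "0 < \<Delta>" using assms(4) S0 n0 by (simp add: \<Delta>_def)
  have "\<Delta> \<le> a / 20" using mult_left_mono[OF Sn, of "a / 20"] assms(4) n0
    by (simp add: \<Delta>_def divide_le_eq)
  then have \<Delta>h: "\<Delta> \<le> 1 / 2" using assms(5) by simp
  \<comment> \<open>\<open>K \<le> S \<le> k\<close> places the prior in
    \<open>B0 k\<close>.\<close>
  have Kk: "K \<le> k" using blk(2) assms(8) by (simp add: S_def)
  define q0 where "q0 = 1 / real n * sqrt (real p / real n)"
  define q1 where "q1 = real p * ln (real p) / (real n)\<^sup>2"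
  define C where "C = real p powr (a / 2)"
  have q0: "0 < q0" using n0 p2 by (simp add: q0_def)
  have q1: "0 < q1" using n0 p2 lp by (simp add: q1_def)
  have \<Delta>2: "\<Delta>\<^sup>2 / 2 = a\<^sup>2 / 800 * q1"
    using S2 n0 by (simp add: \<Delta>_def q1_def power_mult_distrib power_divide)
  \<comment> \<open>After clearing denominators and squaring, this is the hypothesis on
    \<open>p powr (1 - a)\<close> multiplied by \<open>p powr a * p\<close>: the loss
    \<open>C\<close> from the second moment is absorbed by the gap between the scales
    \<open>q0\<close> and \<open>q1\<close>.\<close>
  have Cq: "C * q0 \<le> q1 / 4"
  proof -
    have "(4 * real n * C * sqrt (real p / real n))\<^sup>2 = 16 * real n * real p powr a * real p"
      using n0 p2 by (simp add: power_mult_distrib C_def powr_power power2_eq_square[of "real n"])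
    also have "\<dots> \<le> real p powr (1 - a) * (ln (real p))\<^sup>2 * (real p powr a * real p)"
      using mult_right_mono[OF assms(6), of "real p powr a * real p"] by (simp add: mult.assoc)
    also have "\<dots> = (real p * ln (real p))\<^sup>2"
    proof -
      have "real p powr (1 - a) * real p powr a = real p" using p2 by (simp add: powr_add[symmetric])
      then show ?thesis by (simp add: power_mult_distrib power2_eq_square ac_simps)
    qed
    finally have "4 * real n * C * sqrt (real p / real n) \<le> real p * ln (real p)"
      by (rule power2_le_imp_le) (use lp in simp)
    then show ?thesis using n0 by (simp add: q0_def q1_def field_simps power2_eq_square)
  qed
  let ?A = "max_risk etahat 1 / ennreal q0" and ?B = "max_risk etahat k / ennreal q1"
  \<comment> \<open>The scales are positive and finite, so dividing and multiplying back is exact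
    even for an infinite risk.\<close>
  have "ennreal q * (x / ennreal q) = x" if "0 < q" for q x
    using that by (subst ennreal_times_divide, subst mult.commute, intro ennreal_mult_divide_eq) auto
  then have A: "max_risk etahat 1 = ennreal q0 * ?A" and B: "max_risk etahat k = ennreal q1 * ?B"
    using q0 q1 by simp_all
  have "ennreal (a\<^sup>2 / 800 * q1)
      \<le> ennreal (exp (real K * (exp (2 * real n * \<Delta> / real K) - 1) / real (p div K))) * max_risk etahat 1
        + max_risk etahat k"
    unfolding \<Delta>2[symmetric] assms(1)
    by (rule max_risk_tradeoff) (use assms blk Kk \<Delta>0 \<Delta>h in auto)
  also have "\<dots> \<le> ennreal C * max_risk etahat 1 + max_risk etahat k"
    using blk(5) p2 by (intro add_mono mult_right_mono ennreal_leI) (auto simp: C_def powr_def \<Delta>_def)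
  also have "\<dots> = ennreal (C * q0) * ?A + ennreal q1 * ?B"
    by (subst A, subst B) (simp add: C_def ennreal_mult' mult.assoc)
  also have "\<dots> \<le> ennreal q1 * ?A + ennreal q1 * ?B"
    using Cq q1 by (intro add_mono mult_right_mono ennreal_leI) auto
  finally have "ennreal (a\<^sup>2 / 800) * ennreal q1 \<le> (?A + ?B) * ennreal q1"
    by (subst (asm) ennreal_mult') (simp_all add: distrib_left mult.commute)
  then have "ennreal (a\<^sup>2 / 800) \<le> ?A + ?B"
    using q1 by (simp add: ennreal_mult_le_mult_iff mult.commute[of _ "ennreal q1"])
  \<comment> \<open>The constant obtained is \<open>1 / (2 * 20\<^sup>2) = 1 / 800\<close>, which
    exceeds \<open>1 / 4 ^ 5 = 1 / 1024\<close>.\<close>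
  moreover have "ennreal (a\<^sup>2 / 4 ^ 5) \<le> ennreal (a\<^sup>2 / 800)"
    by (intro ennreal_leI divide_left_mono) auto
  ultimately show ?thesis unfolding q0_def q1_def by (rule order_trans[rotated])
qed

end
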